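(* Let $s\in\{+1,-1\}$ and $\alpha\ge\beta\ge-\tfrac12$. Then $$\mathbb B_s(I;\alpha,\beta)\ \ge\ \frac{2\,\Gamma(\alpha+2)^{\frac{2}{\alpha+1}}}{(4e^{1/12})^{\frac{2}{\alpha+1}}(\alpha+\beta+2)(\alpha+2)}.$$ Moreover $\mathbb B_+(I;\alpha,\beta)\le2$ and $\mathbb B_-(I;\alpha,\beta)\le8$.
   Context: $I=[-1,1]$. For $\alpha,\beta>-1$, $w_{\alpha,\beta}(x)=c_{\alpha,\beta}(1-x)^\alpha(1+x)^\beta$ on $I$, with $c_{\alpha,\beta}$ chosen so that $w_{\alpha,\beta}(x)dx$ is a probability measure. $P^{(\alpha,\beta)}_n$ are the Jacobi polynomials (degree $n$, orthogonal on $I$ with respect to $w_{\alpha,\beta}$, normalized by $P^{(\alpha,\beta)}_n(1)=\binom{n+\alpha}{n}$), and $p^{(\alpha,\beta)}_n=P^{(\alpha,\beta)}_n/\|P^{(\alpha,\beta)}_n\|_{L^2(w_{\alpha,\beta})}$ is the orthonormal basis of $L^2(I,w_{\alpha,\beta})$. For real $f\in L^2(I,w_{\alpha,\beta})$, $\widehat f(n)=\int_I f\,p^{(\alpha,\beta)}_n w_{\alpha,\beta}\,dx$. $\mathcal B_s(I;\alpha,\beta)$ is the set of continuous $f:I\to\mathbb R$ with $\widehat f(0)\le0$, $\{s\widehat f(n)\}$ eventually nonnegative, and $sf(1)\le0$. For such $f$, $r(f;I)=\inf\{r\in(0,2]: f(x)\ge0\text{ for all }x\in[-1,1-r)\}$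 and $k(s\widehat f)=\min\{k\ge1: s\widehat f(n)\ge0\ \forall n\ge k\}$. $\mathbb B_s(I;\alpha,\beta)=\inf_{f\in\mathcal B_s(I;\alpha,\beta)\setminus\{0\}}r(f;I)\,k(s\widehat f)^2$. *)

theory Defs
  imports "HOL-Analysis.Analysis"
begin

definition jacobi_weight0 :: "real \<Rightarrow> real \<Rightarrow> real \<Rightarrow> real" where
  "jacobi_weight0 a b x = (1 - x) powr a * (1 + x) powr b"

definition jacobi_weight :: "real \<Rightarrow> real \<Rightarrow> real \<Rightarrow> real" where
  "jacobi_weight a b x =
     jacobi_weight0 a b x / integral {-1..1} (jacobi_weight0 a b)"

(* Jacobi polynomial P_n^{(a,b)} (explicit standard formula; P_n(1) = binom(n+a, n)) *)
definition jacobiP :: "real \<Rightarrow> real \<Rightarrow> nat \<Rightarrow> real \<Rightarrow> real" where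
  "jacobiP a b n x =
     (\<Sum>k=0..n. ((real n + a) gchoose (n - k)) * ((real n + b) gchoose k)
                 * ((x - 1) / 2) ^ k * ((x + 1) / 2) ^ (n - k))"

definition jacobi_on :: "real \<Rightarrow> real \<Rightarrow> nat \<Rightarrow> real \<Rightarrow> real" where
  "jacobi_on a b n x =
     jacobiP a b n x /
       sqrt (integral {-1..1} (\<lambda>y. (jacobiP a b n y)\<^sup>2 * jacobi_weight a b y))"

definition jacobi_coeff :: "real \<Rightarrow> real \<Rightarrow> (real \<Rightarrow> real) \<Rightarrow> nat \<Rightarrow> real" where
  "jacobi_coeff a b f n =
     integral {-1..1} (\<lambda>x. f x * jacobi_on a b n x * jacobi_weight a b x)"

definition classB :: "real \<Rightarrow> real \<Rightarrow> real \<Rightarrow> (real \<Rightarrow> real) set" where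
  "classB s a b = {f. continuous_on {-1..1} f
                      \<and> jacobi_coeff a b f 0 \<le> 0
                      \<and> (\<forall>\<^sub>F n in sequentially. s * jacobi_coeff a b f n \<ge> 0)
                      \<and> s * f 1 \<le> 0}"

definition r_I :: "(real \<Rightarrow> real) \<Rightarrow> real" where
  "r_I f = Inf {r. 0 < r \<and> r \<le> 2 \<and> (\<forall>x. -1 \<le> x \<and> x < 1 - r \<longrightarrow> f x \<ge> 0)}"

definition k_idx :: "real \<Rightarrow> real \<Rightarrow> real \<Rightarrow> (real \<Rightarrow> real) \<Rightarrow> nat" where
  "k_idx s a b f = (LEAST k. k \<ge> 1 \<and> (\<forall>n\<ge>k. s * jacobi_coeff a b f n \<ge> 0))"

definition BB :: "real \<Rightarrow> real \<Rightarrow> real \<Rightarrow> real" where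
  "BB s a b = (INF f \<in> {f \<in> classB s a b. \<exists>x\<in>{-1..1}. f x \<noteq> 0}.
                 r_I f * (real (k_idx s a b f))\<^sup>2)"

end

(* Write w for the normalised weight, p n for the orthonormal Jacobi polynomials, K for the sum of
   p n (1)^2 over n < k and |f|_1 for the integral of |f| w.  Since p n attains its maximal modulus
   at 1 (Sonin), the n-th coefficient of f is at most p n (1) |f|_1.  The nonnegative kernels
   ((1 + x) / 2)^m concentrate at 1 and have nonnegative Jacobi coefficients, so the condition
   s f(1) <= 0 lets the coefficients of index < k control the remaining ones: the sum of
   |coefficient n| p n (1) over all n is at most 2 K |f|_1.  By completeness, the integral of f^2 w
   is then at most 2 K |f|_1^2.  On the other hand f has nonpositive mean and is negative only on
   [1 - r, 1], so |f|_1 is at most twice the integral of |f| w over [1 - r, 1].  By Cauchy-Schwarz,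
   1 <= 8 K w([1 - r, 1]), and K is an explicit quotient of Gamma values, estimated by log-convexity.
   The upper bounds come from f = -1 and f = p 1. *)
theory Submission
  imports Defs
begin

text \<open>The product r k^2 comes from matching exponents: the mass of [1 - r, 1] is of order
  r^(a+1), while K grows at most like k^(2(a+1)). Their product is therefore bounded by a constant
  times (r k^2)^(a+1), and the root of order a + 1 explains the exponent 2/(a+1). The numerical
  constant is 16 = 8 * 2, with a factor 2 lost in bounding (1 + x)^b near 1, and 16 is at most (4
  exp(1/12))^2. That bound on the weight uses 1 + x >= 1, hence r <= 1; for r > 1 it remains to see
  that the claimed bound is at most 1. The facts on the polynomials rest on one closed form, the
  mean of ((1 + x) / 2)^m times P_n, which is a finite difference of a rising factorial. Its
  vanishing for m < n is orthogonality, the case m = n gives the norm, and its sign for m >= n gives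
  the nonnegative coefficients of the kernels. Only the maximum at 1 needs the differential
  equation.\<close>

text \<open>This is the n-th forward difference of \<open>\<lambda>y. pochhammer y m\<close>.
  Pascal's rule splits off one difference, and each difference lowers the order: (y+1)_m - (y)_m = m
  (y+1)_(m-1).\<close>

lemma alternating_binomial_sum_pochhammer:
  fixes x :: real
  shows "(\<Sum>k\<le>n. (-1) ^ k * real (n choose k) * pochhammer (x + real (n - k)) m) =
         (if n \<le> m then fact m / fact (m - n) * pochhammer (x + real n) (m - n) else 0)"
proof (induction n arbitrary: x)
  case 0
  show ?case by simp
next
  case (Suc n)
  define g where "g k = pochhammer (x + real (Suc n - k)) m" for k
  have "(\<Sum>k\<le>Suc n. (-1) ^ k * real (Suc n choose k) * g k) =
        g 0 + (\<Sum>k\<le>n. (-1) ^ Suc k * real (Suc n choose Suc k) * g (Suc k))"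
    by (subst sum.atMost_Suc_shift) simp
  also have "\<dots> = (g 0 + (\<Sum>k\<le>n. (-1) ^ Suc k * real (n choose Suc k) * g (Suc k)))
                  - (\<Sum>k\<le>n. (-1) ^ k * real (n choose k) * g (Suc k))"
    by (simp add: algebra_simps sum.distrib sum_negf sum_subtractf)
  also have "g 0 + (\<Sum>k\<le>n. (-1) ^ Suc k * real (n choose Suc k) * g (Suc k)) =
             (\<Sum>k\<le>Suc n. (-1) ^ k * real (n choose k) * g k)"
    by (subst sum.atMost_Suc_shift) simp
  also have "\<dots> = (\<Sum>k\<le>n. (-1) ^ k * real (n choose k) * g k)"
    by simp
  also have "\<dots> = (\<Sum>k\<le>n. (-1) ^ k * real (n choose k) * pochhammer ((x + 1) + real (n - k)) m)"
    by (intro sum.cong refl) (simp add: g_def Suc_diff_le add_ac)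
  also have "(\<Sum>k\<le>n. (-1) ^ k * real (n choose k) * g (Suc k)) =
             (\<Sum>k\<le>n. (-1) ^ k * real (n choose k) * pochhammer (x + real (n - k)) m)"
    by (simp add: g_def)
  finally have eq: "(\<Sum>k\<le>Suc n. (-1) ^ k * real (Suc n choose k) * g k) =
      (if n \<le> m then fact m / fact (m - n) * pochhammer (x + 1 + real n) (m - n) else 0)
      - (if n \<le> m then fact m / fact (m - n) * pochhammer (x + real n) (m - n) else 0)"
    by (simp only: Suc.IH)
  show ?case
  proof (cases "n < m")
    case True
    then obtain j where j: "m = Suc (n + j)"
      using less_iff_Suc_add by auto
    define y where "y = x + real n"
    have "pochhammer (y + 1) (Suc j) - pochhammer y (Suc j) = real (Suc j) * pochhammer (y + 1) j"
      by (subst pochhammer_Suc, subst pochhammer_rec) (simp add: algebra_simps)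
    then have "pochhammer (x + 1 + real n) (Suc j) - pochhammer (x + real n) (Suc j)
               = real (Suc j) * pochhammer (x + 1 + real n) j"
      by (simp add: y_def add_ac)
    then have "fact m / fact (Suc j) * (pochhammer (x + 1 + real n) (Suc j) - pochhammer (x + real n) (Suc j))
        = fact m / fact j * pochhammer (x + 1 + real n) j"
      by (simp only: fact_Suc) (simp del: of_nat_Suc)
    with eq show ?thesis
      by (simp add: j g_def Suc_diff_le add_ac right_diff_distrib del: sum.atMost_Suc fact_Suc)
  next
    case False
    with eq show ?thesis
      by (cases "n = m") (simp_all add: g_def del: sum.atMost_Suc)
  qed
qed

lemma poly_eq_sum_atMost:
  fixes q :: "real poly"
  assumes "degree q \<le> n"
  shows "poly q y = (\<Sum>i\<le>n. coeff q i * y ^ i)"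
  unfolding poly_altdef using assms
  by (intro sum.mono_neutral_left) (auto simp: coeff_eq_0)

text \<open>By log-convexity the slope of ln Gamma over [x, x+c] is at most its slope over
  [x+c, x+c+1], and the latter equals ln (x+c) by the functional equation.\<close>

lemma Gamma_add_le:
  fixes x c :: real
  assumes "x > 0" "c > 0"
  shows "Gamma (x + c) \<le> (x + c) powr c * Gamma x"
proof -
  define f where "f = (ln \<circ> Gamma :: real \<Rightarrow> real)"
  have conv: "convex_on {0<..} f" unfolding f_def by (rule log_convex_Gamma_real)
  have "(f x - f (x + c)) / (x - (x + c)) \<le> (f x - f (x + c + 1)) / (x - (x + c + 1))"
    by (rule convex_on_slope_le(1)[OF conv]) (use assms in auto)
  also have "\<dots> \<le> (f (x + c) - f (x + c + 1)) / (x + c - (x + c + 1))"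
    by (rule convex_on_slope_le(2)[OF conv]) (use assms in auto)
  also have "\<dots> = f (x + c + 1) - f (x + c)" by simp
  also have "\<dots> = ln (x + c)"
  proof -
    have "Gamma (x + c + 1) = (x + c) * Gamma (x + c)"
      using assms by (intro Gamma_plus1) (auto elim!: nonpos_Ints_cases')
    moreover have "Gamma (x + c) > 0" using assms by (intro Gamma_real_pos) auto
    ultimately show ?thesis using assms by (simp add: f_def ln_mult_pos)
  qed
  finally have "f (x + c) - f x \<le> c * ln (x + c)"
    using assms by (simp add: field_simps)
  then have "exp (f (x + c)) \<le> exp (c * ln (x + c) + f x)" by simp
  then show ?thesis
    using assms by (simp add: f_def exp_add powr_def)
qed

lemma has_integral_one_minus_powr:
  fixes a r :: real
  assumes "a > -1" "r \<ge> 0"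
  shows "((\<lambda>x. (1 - x) powr a) has_integral r powr (a + 1) / (a + 1)) {1 - r..1}"
proof -
  have "((\<lambda>x. (-x) powr a) has_integral r powr (a + 1) / (a + 1)) (cbox (-r) (-0))"
    using has_integral_powr_from_0[OF assms] by (simp only: box_real has_integral_reflect_real[of "\<lambda>x. x powr a"])
  from has_integral_affinity'[OF this, of 1 "-1"]
  show ?thesis by (simp add: add.commute)
qed

subsection \<open>Integration against the Jacobi weight\<close>

locale jacobi_parameters =
  fixes a b :: real
  assumes b_ge: "b \<ge> -1/2" and b_le_a: "b \<le> a"
begin

lemma a_ge: "a \<ge> -1/2"
  using b_ge b_le_a by linarith

definition mean :: "(real \<Rightarrow> real) \<Rightarrow> real" where
  "mean g = integral {-1..1} (\<lambda>x. g x * jacobi_weight a b x)"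

text \<open>The substitution t = (1 + x) / 2 turns this into the Beta integral on [0, 1].\<close>

lemma weight0_moment:
  "((\<lambda>x. ((1 - x) / 2) ^ i * ((1 + x) / 2) ^ j * jacobi_weight0 a b x) has_integral
     2 powr (a + b + 1) * Beta (a + 1 + real i) (b + 1 + real j)) {-1..1}"
proof -
  have "((\<lambda>t. t powr (b + 1 + real j - 1) * (1 - t) powr (a + 1 + real i - 1)) has_integral
           Beta (b + 1 + real j) (a + 1 + real i)) (cbox 0 1)"
    using has_integral_Beta_real[of "b + 1 + real j" "a + 1 + real i"] a_ge b_ge by simp
  from has_integral_affinity'[OF this, of "1/2" "1/2"]
  have *: "((\<lambda>x. ((1 + x) / 2) powr (b + real j) * ((1 - x) / 2) powr (a + real i)) has_integral
           2 * Beta (a + 1 + real i) (b + 1 + real j)) {-1..1}"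
    by (simp add: Beta_commute add_divide_distrib diff_divide_distrib add_ac)
  have "((\<lambda>x. 2 powr (a + b) * (((1 + x) / 2) powr (b + real j) * ((1 - x) / 2) powr (a + real i)))
          has_integral 2 powr (a + b) * (2 * Beta (a + 1 + real i) (b + 1 + real j))) {-1..1}"
    by (rule has_integral_mult_right[OF *])
  moreover have "2 powr (a + b) * (((1 + x) / 2) powr (b + real j) * ((1 - x) / 2) powr (a + real i))
      = ((1 - x) / 2) ^ i * ((1 + x) / 2) ^ j * jacobi_weight0 a b x" if "x \<in> {-1..1}" for x
  \<comment> \<open>At the endpoints both sides are 0, because \<open>0 powr z = 0\<close> for every
    \<open>z\<close>, including \<open>z = 0\<close>.\<close>
  proof (cases "x = 1 \<or> x = -1")
    case False
    then have x: "1 - x > 0" "1 + x > 0" using that by auto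
    then show ?thesis
      by (simp add: jacobi_weight0_def powr_add powr_divide powr_realpow field_simps)
  qed (auto simp: jacobi_weight0_def)
  moreover have "2 powr (a + b) * (2 * B) = 2 powr (a + b + 1) * B" for B :: real
    by (simp add: powr_add)
  ultimately show ?thesis
    by (metis (no_types, lifting) has_integral_eq)
qed

lemma Beta_pos: "Beta (a + 1) (b + 1) > 0"
  using a_ge b_ge by (simp add: Beta_def)

lemma integral_weight0: "integral {-1..1} (jacobi_weight0 a b) = 2 powr (a + b + 1) * Beta (a + 1) (b + 1)"
  using weight0_moment[of 0 0] by (simp add: integral_unique)

lemma weight_nonneg: "jacobi_weight a b x \<ge> 0"
  unfolding jacobi_weight_def integral_weight0 using Beta_pos
  by (simp add: jacobi_weight0_def)

lemma weight_pos: "-1 < x \<Longrightarrow> x < 1 \<Longrightarrow> jacobi_weight a b x > 0"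
  unfolding jacobi_weight_def integral_weight0 using Beta_pos
  by (simp add: jacobi_weight0_def)

lemma weight_integrable: "jacobi_weight a b absolutely_integrable_on {-1..1}"
proof (rule nonnegative_absolutely_integrable_1)
  have "(jacobi_weight0 a b) integrable_on {-1..1}"
    using weight0_moment[of 0 0] by (auto simp: integrable_on_def)
  then show "jacobi_weight a b integrable_on {-1..1}"
    unfolding jacobi_weight_def[abs_def] divide_inverse by (rule integrable_on_mult_left)
qed (rule weight_nonneg)

lemma mean_integrable:
  assumes "continuous_on {-1..1} g"
  shows "(\<lambda>x. g x * jacobi_weight a b x) integrable_on {-1..1}"
proof -
  have "(\<lambda>x. g x * jacobi_weight a b x) absolutely_integrable_on {-1..1}"
  proof (rule absolutely_integrable_bounded_measurable_product_real)
    show "g \<in> borel_measurable (lebesgue_on {-1..1})"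
      by (rule continuous_imp_measurable_on_sets_lebesgue[OF assms]) auto
    show "bounded (g ` {-1..1})"
      by (intro compact_imp_bounded compact_continuous_image assms) simp
  qed (auto intro: weight_integrable)
  then show ?thesis by (rule set_lebesgue_integral_eq_integral(1))
qed

text \<open>Gamma quotients with integer shifts are rising factorials, so later moment computations
  become purely algebraic.\<close>

lemma mean_moment:
  "mean (\<lambda>x. ((1 - x) / 2) ^ i * ((1 + x) / 2) ^ j) =
     pochhammer (a + 1) i * pochhammer (b + 1) j / pochhammer (a + b + 2) (i + j)"
proof -
  have "mean (\<lambda>x. ((1 - x) / 2) ^ i * ((1 + x) / 2) ^ j) =
        integral {-1..1} (\<lambda>x. ((1 - x) / 2) ^ i * ((1 + x) / 2) ^ j * jacobi_weight0 a b x)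
          / integral {-1..1} (jacobi_weight0 a b)"
    unfolding mean_def jacobi_weight_def by simp
  also have "\<dots> = Beta (a + 1 + real i) (b + 1 + real j) / Beta (a + 1) (b + 1)"
    unfolding integral_weight0 using weight0_moment[of i j] by (simp add: integral_unique)
  also have "\<dots> = (Gamma (a + 1 + real i) / Gamma (a + 1)) * (Gamma (b + 1 + real j) / Gamma (b + 1))
                  / (Gamma (a + b + 2 + real (i + j)) / Gamma (a + b + 2))"
    by (simp add: Beta_def add_ac)
  also have "\<dots> = pochhammer (a + 1) i * pochhammer (b + 1) j / pochhammer (a + b + 2) (i + j)"
    using a_ge b_ge by (subst (1 2 3) pochhammer_Gamma) (auto elim!: nonpos_Ints_cases')
  finally show ?thesis .
qed

lemma mean_add:
  "continuous_on {-1..1} f \<Longrightarrow> continuous_on {-1..1} g \<Longrightarrow>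
   mean (\<lambda>x. f x + g x) = mean f + mean g"
  unfolding mean_def by (simp add: distrib_right integral_add mean_integrable)

lemma mean_diff:
  "continuous_on {-1..1} f \<Longrightarrow> continuous_on {-1..1} g \<Longrightarrow>
   mean (\<lambda>x. f x - g x) = mean f - mean g"
  unfolding mean_def by (simp add: left_diff_distrib integral_diff mean_integrable)

lemma mean_cmult: "mean (\<lambda>x. c * f x) = c * mean f"
  unfolding mean_def by (simp add: mult.assoc)

lemma mean_sum:
  "finite A \<Longrightarrow> (\<And>i. i \<in> A \<Longrightarrow> continuous_on {-1..1} (f i)) \<Longrightarrow>
   mean (\<lambda>x. \<Sum>i\<in>A. f i x) = (\<Sum>i\<in>A. mean (f i))"
  unfolding mean_def sum_distrib_right by (rule integral_sum) (auto intro: mean_integrable)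

lemma mean_cong: "(\<And>x. x \<in> {-1..1} \<Longrightarrow> f x = g x) \<Longrightarrow> mean f = mean g"
  unfolding mean_def by (rule integral_cong) auto

lemma mean_mono:
  "continuous_on {-1..1} f \<Longrightarrow> continuous_on {-1..1} g \<Longrightarrow>
   (\<And>x. x \<in> {-1..1} \<Longrightarrow> f x \<le> g x) \<Longrightarrow> mean f \<le> mean g"
  unfolding mean_def
  by (intro integral_le mean_integrable mult_right_mono weight_nonneg) auto

lemma mean_const [simp]: "mean (\<lambda>x. c) = c"
  using mean_moment[of 0 0] mean_cmult[of c "\<lambda>x. 1"] by simp

lemma abs_mean_le:
  assumes "continuous_on {-1..1} f"
  shows "\<bar>mean f\<bar> \<le> mean (\<lambda>x. \<bar>f x\<bar>)"
proof -
  have "mean f \<le> mean (\<lambda>x. \<bar>f x\<bar>)" "mean (\<lambda>x. (-1) * f x) \<le> mean (\<lambda>x. \<bar>f x\<bar>)"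
    by (intro mean_mono continuous_intros assms; simp)+
  then show ?thesis unfolding mean_cmult by linarith
qed

text \<open>The weight may be singular or vanish at the endpoints. So \<open>f = 0\<close> is
  derived at interior points, on compact subintervals where the integrand is continuous, and then
  extended to the endpoints by continuity of \<open>f\<close>.\<close>

lemma mean_pos:
  assumes cont: "continuous_on {-1..1} f" and nn: "\<And>x. x \<in> {-1..1} \<Longrightarrow> f x \<ge> 0"
    and nz: "\<exists>x\<in>{-1..1}. f x \<noteq> 0"
  shows "mean f > 0"
proof (rule ccontr)
  assume "\<not> mean f > 0"
  moreover have "mean f \<ge> 0"
    using mean_mono[OF _ cont, of "\<lambda>_. 0"] nn by simp
  ultimately have z: "mean f = 0" by simp
  have open_zero: "f x = 0" if x: "x \<in> {-1<..<1}" for x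
  proof -
    let ?g = "\<lambda>x. f x * jacobi_weight a b x"
    define c d where "c = (x - 1) / 2" and "d = (x + 1) / 2"
    have cd: "-1 < c" "c < x" "x < d" "d < 1" using x by (auto simp: c_def d_def)
    have g: "?g integrable_on {c..d}"
      by (rule integrable_subinterval_real[OF mean_integrable[OF cont]]) (use cd in auto)
    have "integral {c..d} ?g \<le> integral {-1..1} ?g"
      using cd nn by (intro integral_subset_le g mean_integrable cont) (auto intro!: mult_nonneg_nonneg weight_nonneg)
    moreover have "integral {c..d} ?g \<ge> 0"
      using cd nn by (intro integral_nonneg g) (auto intro!: mult_nonneg_nonneg weight_nonneg)
    ultimately have "(?g has_integral 0) (cbox c d)"
      using g z by (simp add: mean_def has_integral_iff)
    moreover have "continuous_on (cbox c d) ?g"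
      unfolding jacobi_weight_def jacobi_weight0_def using cd Beta_pos integral_weight0
      by (intro continuous_intros continuous_on_subset[OF cont]) (auto simp: jacobi_weight0_def[abs_def])
    ultimately have "?g x = 0"
      using cd nn by (intro has_integral_0_cbox_imp_0[of c d ?g])
        (auto intro!: mult_nonneg_nonneg weight_nonneg)
    then show "f x = 0" using weight_pos[of x] x by simp
  qed
  have "f x = 0" if "x \<in> {-1..1}" for x
    using continuous_constant_on_closure[of "{-1<..<1}" f 0] cont open_zero that by simp
  with nz show False by blast
qed

subsection \<open>Orthogonality of the Jacobi polynomials\<close>

definition jacobiP_coeff :: "nat \<Rightarrow> nat \<Rightarrow> real" where
  "jacobiP_coeff n k = ((real n + a) gchoose (n - k)) * ((real n + b) gchoose k)"

lemma jacobiP_altdef: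
  "jacobiP a b n x = (\<Sum>k=0..n. jacobiP_coeff n k * ((x - 1) / 2) ^ k * ((x + 1) / 2) ^ (n - k))"
  by (simp add: jacobiP_def jacobiP_coeff_def)

lemma continuous_on_jacobiP [continuous_intros]: "continuous_on A (jacobiP a b n)"
  unfolding jacobiP_def[abs_def] by (intro continuous_intros) auto

lemma jacobiP_coeff_pochhammer:
  assumes "k \<le> n"
  shows "jacobiP_coeff n k = pochhammer (a + 1 + real k) (n - k) * pochhammer (b + 1 + real (n - k)) k
                  / (fact (n - k) * fact k)"
  using assms by (simp add: jacobiP_coeff_def gbinomial_pochhammer' of_nat_diff algebra_simps)

lemma jacobiP_coeff_pos: "k \<le> n \<Longrightarrow> jacobiP_coeff n k > 0"
  unfolding jacobiP_coeff_pochhammer using a_ge b_ge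
  by (intro divide_pos_pos mult_pos_pos pochhammer_pos) auto

text \<open>Writing (x-1)/2 = -((1-x)/2) makes the expansion alternate in sign. After the moments
  are inserted, the factors depending on \<open>k\<close> combine to a binomial coefficient times a
  shifted rising factorial, so the sum is the finite difference evaluated above.\<close>

lemma mean_power_jacobiP:
  "mean (\<lambda>x. ((1 + x) / 2) ^ m * jacobiP a b n x) =
     (if n \<le> m then pochhammer (a + 1) n * pochhammer (b + 1) m * fact m
                      / (fact n * fact (m - n) * pochhammer (a + b + 2) (m + n)) else 0)"
proof -
  have "mean (\<lambda>x. ((1 + x) / 2) ^ m * jacobiP a b n x) =
        mean (\<lambda>x. \<Sum>k\<le>n. ((-1) ^ k * jacobiP_coeff n k) * (((1 - x) / 2) ^ k * ((1 + x) / 2) ^ (m + (n - k))))"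
  proof (rule mean_cong)
    fix x :: real
    have "(x - 1) / 2 = (-1) * ((1 - x) / 2)" by simp
    then have "((x - 1) / 2) ^ k = (-1) ^ k * ((1 - x) / 2) ^ k" for k
      by (simp only: power_mult_distrib)
    then show "((1 + x) / 2) ^ m * jacobiP a b n x =
      (\<Sum>k\<le>n. ((-1) ^ k * jacobiP_coeff n k) * (((1 - x) / 2) ^ k * ((1 + x) / 2) ^ (m + (n - k))))"
      unfolding jacobiP_altdef sum_distrib_left atLeast0AtMost
      by (intro sum.cong refl) (simp only: power_add add.commute[of x] mult_ac)
  qed
  also have "\<dots> = (\<Sum>k\<le>n. mean (\<lambda>x. ((-1) ^ k * jacobiP_coeff n k) * (((1 - x) / 2) ^ k * ((1 + x) / 2) ^ (m + (n - k)))))"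
    by (intro mean_sum continuous_intros) auto
  also have "\<dots> = (\<Sum>k\<le>n. ((-1) ^ k * jacobiP_coeff n k) *
       (pochhammer (a + 1) k * pochhammer (b + 1) (m + (n - k)) / pochhammer (a + b + 2) (k + (m + (n - k)))))"
    by (simp only: mean_cmult mean_moment)
  also have "\<dots> = (\<Sum>k\<le>n. pochhammer (a + 1) n * pochhammer (b + 1) n / (fact n * pochhammer (a + b + 2) (m + n))
       * ((-1) ^ k * real (n choose k) * pochhammer (b + 1 + real (n - k)) m))"
  proof (intro sum.cong refl)
    fix k assume "k \<in> {..n}"
    then have k: "k \<le> n" by simp
    have A: "pochhammer (a + 1) n = pochhammer (a + 1) k * pochhammer (a + 1 + real k) (n - k)"
      by (rule pochhammer_product[OF k])
    have B: "pochhammer (b + 1) n = pochhammer (b + 1) (n - k) * pochhammer (b + 1 + real (n - k)) k"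
      using pochhammer_product[of "n - k" n "b + 1"] k by simp
    have C: "pochhammer (b + 1) (m + (n - k)) = pochhammer (b + 1) (n - k) * pochhammer (b + 1 + real (n - k)) m"
      using pochhammer_product'[of "b + 1" "n - k" m] by (simp add: add.commute)
    have D: "k + (m + (n - k)) = m + n" using k by simp
    have E: "real (n choose k) = fact n / (fact k * fact (n - k))"
      by (rule binomial_fact[OF k])
    have "fact n \<noteq> (0::real)" by simp
    then show "((-1) ^ k * jacobiP_coeff n k) *
       (pochhammer (a + 1) k * pochhammer (b + 1) (m + (n - k)) / pochhammer (a + b + 2) (k + (m + (n - k))))
      = pochhammer (a + 1) n * pochhammer (b + 1) n / (fact n * pochhammer (a + b + 2) (m + n))
       * ((-1) ^ k * real (n choose k) * pochhammer (b + 1 + real (n - k)) m)"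
      unfolding jacobiP_coeff_pochhammer[OF k] A B C D E by simp (simp only: mult_ac)
  qed
  also have "\<dots> = pochhammer (a + 1) n * pochhammer (b + 1) n / (fact n * pochhammer (a + b + 2) (m + n))
     * (if n \<le> m then fact m / fact (m - n) * pochhammer (b + 1 + real n) (m - n) else 0)"
    by (simp only: sum_distrib_left [symmetric] alternating_binomial_sum_pochhammer)
  also have "\<dots> = (if n \<le> m then pochhammer (a + 1) n * pochhammer (b + 1) m * fact m
                      / (fact n * fact (m - n) * pochhammer (a + b + 2) (m + n)) else 0)"
    by (auto simp: pochhammer_product[of n m "b + 1"] mult_ac)
  finally show ?thesis .
qed

lemma mean_power_jacobiP_nonneg: "mean (\<lambda>x. ((1 + x) / 2) ^ m * jacobiP a b n x) \<ge> 0"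
  unfolding mean_power_jacobiP using a_ge b_ge
  by (auto intro!: divide_nonneg_nonneg mult_nonneg_nonneg pochhammer_nonneg)

text \<open>The Jacobi polynomial in the variable t = (1 + x) / 2, in which (x - 1) / 2 is t - 1 and
  the interval is [0, 1].\<close>

definition jacobi_poly :: "nat \<Rightarrow> real poly" where
  "jacobi_poly n = (\<Sum>k=0..n. smult (jacobiP_coeff n k) ([:-1, 1:] ^ k * [:0, 1:] ^ (n - k)))"

lemma poly_jacobi_poly: "poly (jacobi_poly n) ((1 + x) / 2) = jacobiP a b n x"
proof -
  have "(1 + x) / 2 - 1 = (x - 1) / 2" by (simp add: field_simps)
  then show ?thesis
    by (simp add: jacobi_poly_def jacobiP_altdef poly_sum poly_power add.commute mult_ac)
qed

lemma jacobi_poly_summand: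
  assumes "k \<le> n"
  shows "degree ([:-1, 1:] ^ k * [:0, 1::real:] ^ (n - k)) = n"
    and "coeff ([:-1, 1:] ^ k * [:0, 1::real:] ^ (n - k)) n = 1"
proof -
  show *: "degree ([:-1, 1:] ^ k * [:0, 1::real:] ^ (n - k)) = n"
    using assms by (subst degree_mult_eq) (auto simp: degree_power_eq)
  have "lead_coeff ([:-1, 1:] ^ k * [:0, 1::real:] ^ (n - k)) = 1"
    by (simp add: lead_coeff_mult lead_coeff_power)
  then show "coeff ([:-1, 1:] ^ k * [:0, 1::real:] ^ (n - k)) n = 1"
    by (simp only: *)
qed

lemma degree_jacobi_poly: "degree (jacobi_poly n) \<le> n"
  unfolding jacobi_poly_def
  by (intro degree_sum_le) (auto intro!: order.trans[OF degree_smult_le] simp: jacobi_poly_summand)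

lemma coeff_jacobi_poly: "coeff (jacobi_poly n) n = (2 * real n + a + b) gchoose n"
proof -
  have "coeff (jacobi_poly n) n = (\<Sum>k=0..n. jacobiP_coeff n k)"
    by (simp add: jacobi_poly_def coeff_sum jacobi_poly_summand)
  also have "\<dots> = (\<Sum>k=0..n. ((real n + b) gchoose k) * ((real n + a) gchoose (n - k)))"
    by (simp add: jacobiP_coeff_def mult.commute)
  also have "\<dots> = ((real n + b) + (real n + a)) gchoose n"
    by (rule gbinomial_Vandermonde)
  finally show ?thesis by (simp add: algebra_simps)
qed

lemma coeff_jacobi_poly_pos: "coeff (jacobi_poly n) n > 0"
  unfolding jacobi_poly_def by (auto simp: coeff_sum jacobi_poly_summand intro!: sum_pos jacobiP_coeff_pos)

lemma mean_poly_jacobiP: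
  assumes "degree q \<le> n"
  shows "mean (\<lambda>x. poly q ((1 + x) / 2) * jacobiP a b n x) =
         coeff q n * mean (\<lambda>x. ((1 + x) / 2) ^ n * jacobiP a b n x)"
proof -
  have "mean (\<lambda>x. poly q ((1 + x) / 2) * jacobiP a b n x) =
        mean (\<lambda>x. \<Sum>i\<le>n. coeff q i * (((1 + x) / 2) ^ i * jacobiP a b n x))"
    by (simp add: poly_eq_sum_atMost[OF assms] sum_distrib_right mult.assoc)
  also have "\<dots> = (\<Sum>i\<le>n. mean (\<lambda>x. coeff q i * (((1 + x) / 2) ^ i * jacobiP a b n x)))"
    by (intro mean_sum continuous_intros) auto
  also have "\<dots> = (\<Sum>i\<le>n. if i = n then coeff q i * mean (\<lambda>x. ((1 + x) / 2) ^ i * jacobiP a b n x) else 0)"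
    unfolding mean_cmult by (intro sum.cong refl) (auto simp: mean_power_jacobiP)
  finally show ?thesis by simp
qed

definition jacobi_sq_norm :: "nat \<Rightarrow> real" where
  "jacobi_sq_norm n = mean (\<lambda>x. (jacobiP a b n x)\<^sup>2)"

text \<open>One factor of the square is expanded in powers of t. Orthogonality kills all but the
  leading power, whose coefficient is a Vandermonde sum.\<close>

lemma jacobi_sq_norm_eq:
  "jacobi_sq_norm n = ((2 * real n + a + b) gchoose n) * pochhammer (a + 1) n * pochhammer (b + 1) n
              / pochhammer (a + b + 2) (2 * n)"
proof -
  have "jacobi_sq_norm n = coeff (jacobi_poly n) n * mean (\<lambda>x. ((1 + x) / 2) ^ n * jacobiP a b n x)"
    using mean_poly_jacobiP[OF degree_jacobi_poly, of n]
    by (simp only: poly_jacobi_poly jacobi_sq_norm_def power2_eq_square)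
  then show ?thesis
    unfolding coeff_jacobi_poly mean_power_jacobiP mult_2 by simp
qed

lemma jacobi_sq_norm_pos: "jacobi_sq_norm n > 0"
  unfolding jacobi_sq_norm_eq coeff_jacobi_poly [symmetric] using a_ge b_ge
  by (intro divide_pos_pos mult_pos_pos pochhammer_pos coeff_jacobi_poly_pos) auto

lemma jacobiP_orthogonal:
  assumes "m < n"
  shows "mean (\<lambda>x. jacobiP a b m x * jacobiP a b n x) = 0"
proof -
  have "degree (jacobi_poly m) < n" using degree_jacobi_poly[of m] assms by simp
  then show ?thesis
    using mean_poly_jacobiP[of "jacobi_poly m" n] by (simp add: poly_jacobi_poly coeff_eq_0)
qed

lemma jacobi_on_altdef: "jacobi_on a b n x = jacobiP a b n x / sqrt (jacobi_sq_norm n)"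
  by (simp add: jacobi_on_def jacobi_sq_norm_def mean_def)

lemma jacobi_coeff_altdef: "jacobi_coeff a b f n = mean (\<lambda>x. f x * jacobi_on a b n x)"
  by (simp add: jacobi_coeff_def mean_def)

lemma continuous_on_jacobi_on [continuous_intros]: "continuous_on A (jacobi_on a b n)"
  unfolding jacobi_on_altdef[abs_def]
  by (intro continuous_intros) (use jacobi_sq_norm_pos[of n] in auto)

lemma jacobi_on_orthonormal:
  "mean (\<lambda>x. jacobi_on a b m x * jacobi_on a b n x) = (if m = n then 1 else 0)"
proof -
  have "mean (\<lambda>x. jacobi_on a b m x * jacobi_on a b n x) =
        mean (\<lambda>x. (1 / (sqrt (jacobi_sq_norm m) * sqrt (jacobi_sq_norm n))) * (jacobiP a b m x * jacobiP a b n x))"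
    by (rule mean_cong) (simp add: jacobi_on_altdef)
  also have "\<dots> = (1 / (sqrt (jacobi_sq_norm m) * sqrt (jacobi_sq_norm n))) * mean (\<lambda>x. jacobiP a b m x * jacobiP a b n x)"
    by (rule mean_cmult)
  also have "\<dots> = (if m = n then 1 else 0)"
  proof (cases m n rule: linorder_cases)
    case equal
    then show ?thesis using jacobi_sq_norm_pos[of n]
      by (simp add: jacobi_sq_norm_def [symmetric] power2_eq_square [symmetric])
  next
    case greater
    then show ?thesis using jacobiP_orthogonal[of n m] by (simp add: mult.commute)
  qed (simp add: jacobiP_orthogonal)
  finally show ?thesis .
qed

lemma jacobi_on_0 [simp]: "jacobi_on a b 0 x = 1"
  by (simp add: jacobi_on_altdef jacobi_sq_norm_def jacobiP_def)

lemma poly_in_span_jacobi_on: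
  assumes "degree q \<le> N"
  shows "\<exists>c. \<forall>x. poly q ((1 + x) / 2) = (\<Sum>n\<le>N. c n * jacobi_on a b n x)"
  using assms
proof (induction N arbitrary: q)
  case 0
  then obtain c where "q = [:c:]" by (auto elim: degree_eq_zeroE)
  then show ?case by (intro exI[of _ "\<lambda>_. c"]) simp
next
  case (Suc N)
  \<comment> \<open>Subtracting this multiple of the Jacobi polynomial cancels the leading
    coefficient and leaves degree at most \<open>N\<close>.\<close>
  define d where "d = coeff q (Suc N) / coeff (jacobi_poly (Suc N)) (Suc N)"
  define q' where "q' = q - smult d (jacobi_poly (Suc N))"
  have "degree q' \<le> Suc N"
    unfolding q'_def using Suc.prems degree_jacobi_poly[of "Suc N"]
    by (intro degree_diff_le) (auto intro: order.trans[OF degree_smult_le])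
  moreover have "coeff q' (Suc N) = 0"
    using coeff_jacobi_poly_pos[of "Suc N"] by (simp add: q'_def d_def)
  ultimately have "degree q' \<le> N"
    by (metis degree_0 eq_zero_or_degree_less less_Suc_eq_le nle_le not_less_eq_eq le_antisym leading_coeff_0_iff zero_le)
  then obtain c where c: "\<And>x. poly q' ((1 + x) / 2) = (\<Sum>n\<le>N. c n * jacobi_on a b n x)"
    using Suc.IH by blast
  have "poly q ((1 + x) / 2) = (\<Sum>n\<le>N. c n * jacobi_on a b n x)
          + d * sqrt (jacobi_sq_norm (Suc N)) * jacobi_on a b (Suc N) x" for x
  proof -
    have "poly q ((1 + x) / 2) = poly q' ((1 + x) / 2) + d * jacobiP a b (Suc N) x"
      by (simp add: q'_def poly_jacobi_poly)
    then show ?thesis using jacobi_sq_norm_pos[of "Suc N"] by (simp add: c jacobi_on_altdef)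
  qed
  then show ?case
    by (intro exI[of _ "c(Suc N := d * sqrt (jacobi_sq_norm (Suc N)))"]) simp
qed

lemma mean_mult_sum_jacobi_on:
  assumes "continuous_on {-1..1} f"
  shows "mean (\<lambda>x. f x * (\<Sum>n\<le>N. c n * jacobi_on a b n x)) = (\<Sum>n\<le>N. c n * jacobi_coeff a b f n)"
proof -
  have "mean (\<lambda>x. f x * (\<Sum>n\<le>N. c n * jacobi_on a b n x)) =
        mean (\<lambda>x. \<Sum>n\<le>N. c n * (f x * jacobi_on a b n x))"
    by (simp add: sum_distrib_left mult_ac)
  also have "\<dots> = (\<Sum>n\<le>N. mean (\<lambda>x. c n * (f x * jacobi_on a b n x)))"
    by (intro mean_sum continuous_intros assms) auto
  finally show ?thesis by (simp add: mean_cmult jacobi_coeff_altdef)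
qed

lemma jacobi_coeff_sum_jacobi_on:
  "jacobi_coeff a b (\<lambda>x. \<Sum>n\<le>N. c n * jacobi_on a b n x) m = (if m \<le> N then c m else 0)"
proof -
  have "jacobi_coeff a b (\<lambda>x. \<Sum>n\<le>N. c n * jacobi_on a b n x) m =
        mean (\<lambda>x. jacobi_on a b m x * (\<Sum>n\<le>N. c n * jacobi_on a b n x))"
    by (simp add: jacobi_coeff_altdef mult.commute)
  also have "\<dots> = (\<Sum>n\<le>N. c n * (if m = n then 1 else 0))"
    by (subst mean_mult_sum_jacobi_on) (auto intro: continuous_intros simp: jacobi_coeff_altdef jacobi_on_orthonormal)
  finally show ?thesis by (auto simp: sum.delta' if_distrib cong: if_cong)
qed

subsection \<open>The differential equation and the maximum at 1\<close>

text \<open>This relation between neighbouring coefficients is exactly what makes the sums in the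
  differential equation cancel.\<close>

lemma jacobiP_coeff_rec:
  assumes "k < n"
  shows "jacobiP_coeff n (Suc k) * (real (Suc k) * (real (Suc k) + a)) = jacobiP_coeff n k * (real (n - k) * (real (n - k) + b))"
proof -
  obtain i where i: "n - k = Suc i" using assms by (metis Suc_diff_Suc)
  then have n: "n = Suc (k + i)" using assms by simp
  have rec: "(z - real m) * (z gchoose m) = real (Suc m) * (z gchoose Suc m)" for z :: real and m
    using gbinomial_mult_1[of z m] by (simp add: algebra_simps)
  have 1: "(a + real k + 1) * ((real n + a) gchoose i) = real (Suc i) * ((real n + a) gchoose Suc i)"
    using rec[of "real n + a" i] by (simp add: n add_ac)
  have 2: "(b + real (Suc i)) * ((real n + b) gchoose k) = real (Suc k) * ((real n + b) gchoose Suc k)"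
    using rec[of "real n + b" k] by (simp add: n add_ac)
  have "jacobiP_coeff n (Suc k) * (real (Suc k) * (real (Suc k) + a)) =
        ((a + real k + 1) * ((real n + a) gchoose i)) * (real (Suc k) * ((real n + b) gchoose Suc k))"
    by (simp add: jacobiP_coeff_def n algebra_simps)
  also have "\<dots> = (real (Suc i) * ((real n + a) gchoose Suc i)) * ((b + real (Suc i)) * ((real n + b) gchoose k))"
    by (simp only: 1 2)
  also have "\<dots> = jacobiP_coeff n k * (real (n - k) * (real (n - k) + b))"
    by (simp add: jacobiP_coeff_def i mult_ac add_ac)
  finally show ?thesis .
qed

text \<open>On the products (t-1)^k t^j with k + j fixed, the Jacobi operator is tridiagonal: it
  only reaches the two neighbours with one factor exchanged.\<close>

lemma jacobi_operator_monomial: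
  fixes k j :: nat and t :: real
  defines "e \<equiv> [:-1, 1:] ^ k * [:0, 1::real:] ^ j"
  defines "E \<equiv> \<lambda>k j. (t - 1) ^ k * t ^ j"
  shows "t * (1 - t) * poly (pderiv (pderiv e)) t + (b + 1 - (a + b + 2) * t) * poly (pderiv e) t
           + real (k + j) * (real (k + j) + a + b + 1) * poly e t =
         - (real k * (real k + a) * (E (k - 1) (j + 1) - E k j)
            + real j * (real j + b) * (E (k + 1) (j - 1) - E k j))"
proof -
  have d: "pderiv ([:-1, 1:] ^ k * [:0, 1::real:] ^ j) =
      smult (real k) ([:-1, 1:] ^ (k - 1) * [:0, 1:] ^ j)
      + smult (real j) ([:-1, 1:] ^ k * [:0, 1:] ^ (j - 1))" for k j
    by (simp add: pderiv_mult pderiv_power pderiv_pCons mult_ac smult_add_right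
        del: pderiv_power_Suc)
  have p: "poly ([:-1, 1:] ^ k * [:0, 1::real:] ^ j) t = E k j" for k j
    by (simp add: E_def poly_power)
  have 1: "poly (pderiv e) t = real k * E (k - 1) j + real j * E k (j - 1)"
    by (simp only: e_def d poly_add poly_smult p)
  have 2: "poly (pderiv (pderiv e)) t =
      real k * (real (k - 1) * E (k - 1 - 1) j + real j * E (k - 1) (j - 1))
      + real j * (real k * E (k - 1) (j - 1) + real (j - 1) * E k (j - 1 - 1))"
    by (simp only: e_def d pderiv_add pderiv_smult poly_add poly_smult p)
  \<comment> \<open>These identities absorb the truncated subtractions: wherever
    \<open>k - 1\<close> or \<open>j - 1\<close> is cut off at 0, a vanishing factor stands in
    front.\<close>
  have u: "real k * ((t - 1) * E (k - 1) j') = real k * E k j'" for j'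
    by (cases k) (simp_all add: E_def)
  have v: "real j * (t * E k' (j - 1)) = real j * E k' j" for k'
    by (cases j) (simp_all add: E_def)
  have uu: "real k * real (k - 1) * ((t - 1) * E (k - 1 - 1) j) = real k * (real k - 1) * E (k - 1) j"
    by (cases k; cases "k - 1") (simp_all add: E_def)
  have vv: "real j * real (j - 1) * (t * E k (j - 1 - 1)) = real j * (real j - 1) * E k (j - 1)"
    by (cases j; cases "j - 1") (simp_all add: E_def)
  have uv: "real k * real j * ((t - 1) * (t * E (k - 1) (j - 1))) = real k * real j * E k j"
    by (cases k; cases j) (simp_all add: E_def)
  have tE: "t * E k' j' = E k' (j' + 1)" "(t - 1) * E k' j' = E (k' + 1) j'" for k' j'
    by (simp_all add: E_def)
  have "t * (1 - t) * poly (pderiv (pderiv e)) t =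
      - (t * (real k * real (k - 1) * ((t - 1) * E (k - 1 - 1) j))
         + 2 * (real k * real j * ((t - 1) * (t * E (k - 1) (j - 1))))
         + (t - 1) * (real j * real (j - 1) * (t * E k (j - 1 - 1))))"
    unfolding 2 by algebra
  also have "\<dots> = - (real k * (real k - 1) * (t * E (k - 1) j) + 2 * (real k * real j * E k j)
      + real j * (real j - 1) * ((t - 1) * E k (j - 1)))"
    unfolding uu vv uv by algebra
  also have "\<dots> = - (real k * (real k - 1) * E (k - 1) (j + 1) + 2 * (real k * real j * E k j)
      + real j * (real j - 1) * E (k + 1) (j - 1))"
    unfolding tE ..
  finally have A: "t * (1 - t) * poly (pderiv (pderiv e)) t = \<dots>" .
  have "(b + 1 - (a + b + 2) * t) * poly (pderiv e) t =
      - ((b + 1) * (real k * ((t - 1) * E (k - 1) j)) + (b + 1) * (real j * ((t - 1) * E k (j - 1)))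
         + (a + 1) * (real k * (t * E (k - 1) j)) + (a + 1) * (real j * (t * E k (j - 1))))"
    unfolding 1 by algebra
  also have "\<dots> = - ((b + 1) * (real k * E k j) + (b + 1) * (real j * E (k + 1) (j - 1))
         + (a + 1) * (real k * E (k - 1) (j + 1)) + (a + 1) * (real j * E k j))"
    unfolding u v unfolding tE ..
  finally have B: "(b + 1 - (a + b + 2) * t) * poly (pderiv e) t = \<dots>" .
  have C: "poly e t = E k j" by (simp only: e_def p)
  show ?thesis unfolding A B C of_nat_add by algebra
qed

text \<open>The Jacobi equation on [0, 1]. What the operator sends from index k to k+1 cancels
  against what it sends from k+1 to k.\<close>

lemma jacobi_ode:
  "t * (1 - t) * poly (pderiv (pderiv (jacobi_poly n))) t + (b + 1 - (a + b + 2) * t) * poly (pderiv (jacobi_poly n)) t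
     + real n * (real n + a + b + 1) * poly (jacobi_poly n) t = 0"
proof -
  define e where "e k = [:-1, 1:] ^ k * [:0, 1::real:] ^ (n - k)" for k
  define g where "g k = (t - 1) ^ k * t ^ (n - k)" for k
  define A where "A k = jacobiP_coeff n k * (real k * (real k + a))" for k
  define B where "B k = jacobiP_coeff n k * (real (n - k) * (real (n - k) + b))" for k
  have AB: "B k = A (Suc k)" if "k < n" for k
    using jacobiP_coeff_rec[OF that] by (simp only: A_def B_def)
  define Op where "Op q = t * (1 - t) * poly (pderiv (pderiv q)) t + (b + 1 - (a + b + 2) * t) * poly (pderiv q) t
     + real n * (real n + a + b + 1) * poly q t" for q
  have "Op (jacobi_poly n) = (\<Sum>k\<le>n. jacobiP_coeff n k * Op (e k))"
  proof -
    have j: "jacobi_poly n = (\<Sum>k\<le>n. smult (jacobiP_coeff n k) (e k))"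
      by (simp add: jacobi_poly_def e_def atLeast0AtMost)
    have Op_add: "Op (p + q) = Op p + Op q" for p q
      by (simp add: Op_def pderiv_add algebra_simps)
    have Op_smult: "Op (smult c p) = c * Op p" for c p
      by (simp add: Op_def pderiv_smult algebra_simps)
    have Op_0: "Op 0 = 0" by (simp add: Op_def)
    have "Op (\<Sum>k\<in>S. smult (jacobiP_coeff n k) (e k)) = (\<Sum>k\<in>S. jacobiP_coeff n k * Op (e k))" if "finite S" for S
      using that by induction (simp_all add: Op_add Op_smult Op_0)
    then show ?thesis by (simp add: j)
  qed
  also have "\<dots> = (\<Sum>k\<le>n. - (A k * (g (k - 1) - g k) + B k * (g (k + 1) - g k)))"
  proof (intro sum.cong refl)
    fix k assume "k \<in> {..n}"
    then have k: "k \<le> n" by simp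
    have g1: "real k * (real k + a) * ((t - 1) ^ (k - 1) * t ^ (n - k + 1) - g k)
        = real k * (real k + a) * (g (k - 1) - g k)"
      using k by (cases k) (simp_all add: g_def Suc_diff_Suc)
    have g2: "real (n - k) * (real (n - k) + b) * ((t - 1) ^ (k + 1) * t ^ (n - k - 1) - g k)
        = real (n - k) * (real (n - k) + b) * (g (k + 1) - g k)"
      by (simp add: g_def)
    have "Op (e k) = - (real k * (real k + a) * (g (k - 1) - g k)
            + real (n - k) * (real (n - k) + b) * (g (k + 1) - g k))"
      using jacobi_operator_monomial[of t k "n - k"] k g1 g2
      by (simp only: Op_def e_def g_def le_add_diff_inverse)
    then show "jacobiP_coeff n k * Op (e k) = - (A k * (g (k - 1) - g k) + B k * (g (k + 1) - g k))"
      unfolding A_def B_def by algebra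
  qed
  also have "\<dots> = - ((\<Sum>k\<le>n. A k * (g (k - 1) - g k)) + (\<Sum>k\<le>n. B k * (g (k + 1) - g k)))"
    by (simp add: sum_negf sum.distrib del: add_uminus_conv_diff minus_add_distrib)
  \<comment> \<open>Since \<open>A 0 = 0\<close> and \<open>B n = 0\<close>, the boundary terms
    vanish. After an index shift both sums run over \<open>k < n\<close>, and \<open>AB\<close>
    makes them opposite.\<close>
  also have "(\<Sum>k\<le>n. A k * (g (k - 1) - g k)) = (\<Sum>k<n. A (Suc k) * (g k - g (Suc k)))"
  proof -
    have "A 0 = 0" by (simp add: A_def)
    then show ?thesis
      by (cases n) (simp_all add: sum.atMost_Suc_shift lessThan_Suc_atMost del: sum.atMost_Suc)
  qed
  also have "(\<Sum>k\<le>n. B k * (g (k + 1) - g k)) = (\<Sum>k<n. B k * (g (k + 1) - g k))"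
    by (simp add: B_def lessThan_Suc_atMost [symmetric])
  also have "\<dots> = - (\<Sum>k<n. A (Suc k) * (g k - g (Suc k)))"
    unfolding sum_negf [symmetric]
    using AB by (intro sum.cong refl) (simp add: algebra_simps)
  finally show ?thesis by (simp add: Op_def)
qed

lemma jacobiP_at_1: "jacobiP a b n 1 = pochhammer (a + 1) n / fact n"
proof -
  have "jacobiP a b n 1 = (\<Sum>k\<le>n. if k = 0 then jacobiP_coeff n k else 0)"
    unfolding jacobiP_altdef atLeast0AtMost by (intro sum.cong refl) auto
  then show ?thesis by (simp add: jacobiP_coeff_pochhammer)
qed

lemma jacobiP_at_minus_1: "\<bar>jacobiP a b n (-1)\<bar> = pochhammer (b + 1) n / fact n"
proof -
  have "jacobiP a b n (-1) = (\<Sum>k\<le>n. if k = n then jacobiP_coeff n k * (-1) ^ k else 0)"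
    unfolding jacobiP_altdef atLeast0AtMost by (intro sum.cong refl) auto
  then have "jacobiP a b n (-1) = jacobiP_coeff n n * (-1) ^ n" by simp
  then show ?thesis
    using pochhammer_pos[of "b + 1" n] b_ge by (simp add: abs_mult jacobiP_coeff_pochhammer)
qed

lemma jacobiP_at_1_pos: "jacobiP a b n 1 > 0"
  unfolding jacobiP_at_1 using a_ge by (intro divide_pos_pos pochhammer_pos) auto

lemma jacobiP_le_at_1:
  assumes x: "x \<in> {-1..1}"
  shows "\<bar>jacobiP a b n x\<bar> \<le> jacobiP a b n 1"
proof (cases "n = 0")
  case True
  then show ?thesis by (simp add: jacobiP_def)
next
  case False
  define q where "q = jacobi_poly n"
  define l where "l = real n * (real n + a + b + 1)"
  have l: "l > 0" unfolding l_def using False a_ge b_ge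
    by (intro mult_pos_pos add_nonneg_pos) auto
  \<comment> \<open>Sonin's function: it agrees with the square of the polynomial at the endpoints, and by the
    differential equation its derivative has the sign of an increasing affine function.\<close>
  define F where "F t = (poly q t)\<^sup>2 + t * (1 - t) * (poly (pderiv q) t)\<^sup>2 / l" for t
  define G where "G t = 2 * (a + b + 1) * t - (2 * b + 1)" for t
  have F': "(F has_real_derivative (poly (pderiv q) t)\<^sup>2 / l * G t) (at t)" for t
  proof -
    let ?y = "poly q t" and ?y1 = "poly (pderiv q) t" and ?y2 = "poly (pderiv (pderiv q)) t"
    have "(F has_real_derivative (2 * ?y * ?y1
       + ((1 - 2 * t) * ?y1\<^sup>2 + t * (1 - t) * (2 * ?y1 * ?y2)) / l)) (at t)"
      unfolding F_def using l by (auto intro!: derivative_eq_intros poly_DERIV simp: field_simps power2_eq_square)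
    moreover have "2 * ?y * ?y1 + ((1 - 2 * t) * ?y1\<^sup>2 + t * (1 - t) * (2 * ?y1 * ?y2)) / l
       = ?y1\<^sup>2 / l * G t"
    proof -
      have "t * (1 - t) * ?y2 + (b + 1 - (a + b + 2) * t) * ?y1 + l * ?y = 0"
        using jacobi_ode[of t n] by (simp add: q_def l_def)
      then have "2 * l * ?y * ?y1 + ((1 - 2 * t) * ?y1\<^sup>2 + t * (1 - t) * (2 * ?y1 * ?y2)) = ?y1\<^sup>2 * G t"
        unfolding G_def by algebra
      then show ?thesis using l by (simp add: field_simps)
    qed
    ultimately show ?thesis by simp
  qed
  \<comment> \<open>The slope 2 (a + b + 1) is nonnegative because both parameters are at least
    -1/2.\<close>
  have G_mono: "G s \<le> G t" if "s \<le> t" for s t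
    unfolding G_def using that a_ge b_ge by (simp add: mult_left_mono)
  define t where "t = (1 + x) / 2"
  have t: "0 \<le> t" "t \<le> 1" using x by (auto simp: t_def)
  have "F t \<le> max (F 0) (F 1)"
  \<comment> \<open>If \<open>G t\<close> is nonnegative, it stays so on [t, 1] and \<open>F\<close>
    increases there; otherwise \<open>G\<close> is negative on [0, t] and \<open>F\<close> decreases
    there.\<close>
  proof (cases "G t \<ge> 0")
    case True
    have "F t \<le> F 1"
      by (rule DERIV_nonneg_imp_nondecreasing[OF t(2)])
        (use F' G_mono True l in \<open>meson divide_nonneg_pos mult_nonneg_nonneg order.trans zero_le_power2\<close>)
    then show ?thesis by simp
  next
    case False
    have "F t \<le> F 0"
    proof (rule DERIV_nonpos_imp_nonincreasing[OF t(1)])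
      fix s assume "0 \<le> s" "s \<le> t"
      then have "(poly (pderiv q) s)\<^sup>2 / l * G s \<le> 0"
        using G_mono[of s t] False l by (intro mult_nonneg_nonpos) auto
      then show "\<exists>y. (F has_real_derivative y) (at s) \<and> y \<le> 0" using F' by blast
    qed
    then show ?thesis by simp
  qed
  moreover have "F 0 \<le> (jacobiP a b n 1)\<^sup>2"
  proof -
    have "F 0 = (jacobiP a b n (-1))\<^sup>2"
      using poly_jacobi_poly[of n "-1"] by (simp add: F_def q_def)
    \<comment> \<open>Here \<open>b \<le> a\<close> decides that the larger endpoint value is the
      one at 1.\<close>
    moreover have "pochhammer (b + 1) n \<le> pochhammer (a + 1) n"
      unfolding pochhammer_prod using b_le_a b_ge by (intro prod_mono) auto
    then have "\<bar>jacobiP a b n (-1)\<bar> \<le> jacobiP a b n 1"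
      unfolding jacobiP_at_minus_1 jacobiP_at_1 by (simp add: divide_right_mono)
    ultimately show ?thesis
      by (metis abs_ge_zero power2_abs power_mono)
  qed
  moreover have "F 1 = (jacobiP a b n 1)\<^sup>2"
    using poly_jacobi_poly[of n 1] by (simp add: F_def q_def)
  moreover have "(jacobiP a b n x)\<^sup>2 \<le> F t"
    using t l poly_jacobi_poly[of n x] by (simp add: F_def q_def t_def[symmetric])
  ultimately have "(jacobiP a b n x)\<^sup>2 \<le> (jacobiP a b n 1)\<^sup>2" by linarith
  then show ?thesis
    using jacobiP_at_1_pos[of n] by (simp add: abs_le_square_iff [symmetric])
qed

lemma jacobi_on_le_at_1:
  assumes "x \<in> {-1..1}"
  shows "\<bar>jacobi_on a b n x\<bar> \<le> jacobi_on a b n 1"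
  using jacobiP_le_at_1[OF assms, of n] jacobi_sq_norm_pos[of n]
  by (simp add: jacobi_on_altdef abs_mult divide_right_mono)

lemma jacobi_on_at_1_pos: "jacobi_on a b n 1 > 0"
  using jacobiP_at_1_pos[of n] jacobi_sq_norm_pos[of n] by (simp add: jacobi_on_altdef)

text \<open>The diagonal value at (1, 1) of the Christoffel-Darboux kernel. Once the closed form is
  known, induction reduces it to one factorisation of a quadratic in m.\<close>

lemma sum_jacobi_on_at_1_squared:
  "(\<Sum>n\<le>m. (jacobi_on a b n 1)\<^sup>2) =
     pochhammer (a + b + 2) m * pochhammer (a + 2) m / (fact m * pochhammer (b + 1) m)"
proof (induction m)
  case 0
  show ?case by simp
next
  case (Suc m)
  define n where "n = Suc m"
  define s where "s = a + b + 2"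
  have pos: "pochhammer z i > 0" if "z > 0" for z :: real and i
    using that by (rule pochhammer_pos)
  have s: "s > 0" using a_ge b_ge by (simp add: s_def)
  have cancel: "(A / F)\<^sup>2 / (X / F * A * B / (S * X * T)) = A * S * T / (F * B)"
    if "X > 0" "A > 0" "F > 0" for X A B S T F :: real
    using that by (simp add: power2_eq_square)
  have "(jacobi_on a b n 1)\<^sup>2 = (pochhammer (a + 1) n / fact n)\<^sup>2 / jacobi_sq_norm n"
    using jacobi_sq_norm_pos[of n] by (simp add: jacobi_on_altdef jacobiP_at_1 power_divide power_mult_distrib)
  also have "(2 * real n + a + b) gchoose n = pochhammer (s + real m) n / fact n"
    by (simp add: gbinomial_pochhammer' n_def s_def algebra_simps)
  then have "jacobi_sq_norm n = pochhammer (s + real m) n / fact n * pochhammer (a + 1) n * pochhammer (b + 1) n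
     / pochhammer s (2 * n)"
    by (simp add: jacobi_sq_norm_eq s_def)
  \<comment> \<open>With 2n = m + n + 1 the factor (s+m)_n splits off and cancels the one in the
    leading coefficient.\<close>
  also have "pochhammer s (2 * n) = pochhammer s m * pochhammer (s + real m) n * (s + real m + real n)"
  proof -
    have "2 * n = Suc (m + n)" by (simp add: n_def)
    then show ?thesis
      by (simp only: pochhammer_Suc pochhammer_product') (simp add: add_ac)
  qed
  finally have p: "(jacobi_on a b n 1)\<^sup>2 =
      pochhammer (a + 1) n * pochhammer s m * (s + real m + real n) / (fact n * pochhammer (b + 1) n)"
    using cancel[of "pochhammer (s + real m) n" "pochhammer (a + 1) n" "fact n"]
      pos[of "s + real m" n] pos[of "a + 1" n] s a_ge by simp
  have A: "pochhammer (a + 1) n = (a + 1) * pochhammer (a + 2) m"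
    using pochhammer_rec[of "a + 1" m] by (simp add: n_def add_ac)
  have B: "pochhammer s m * pochhammer (a + 2) m / (fact m * pochhammer (b + 1) m)
     = pochhammer s m * pochhammer (a + 2) m * (real n * (b + 1 + real m)) / (fact n * pochhammer (b + 1) n)"
  proof -
    have "fact n * pochhammer (b + 1) n = (fact m * pochhammer (b + 1) m) * (real n * (b + 1 + real m))"
      by (simp add: n_def pochhammer_Suc mult_ac)
    moreover have "real n * (b + 1 + real m) \<noteq> 0" using b_ge by (simp add: n_def)
    ultimately show ?thesis by (simp only: nonzero_mult_divide_mult_cancel_right not_False_eq_True)
  qed
  have C: "pochhammer s n * pochhammer (a + 2) n / (fact n * pochhammer (b + 1) n)
     = pochhammer s m * pochhammer (a + 2) m * ((s + real m) * (a + 2 + real m)) / (fact n * pochhammer (b + 1) n)"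
    by (simp add: n_def pochhammer_Suc mult_ac)
  have "(\<Sum>n\<le>Suc m. (jacobi_on a b n 1)\<^sup>2) =
    pochhammer s m * pochhammer (a + 2) m / (fact m * pochhammer (b + 1) m) + (jacobi_on a b n 1)\<^sup>2"
    using Suc.IH by (simp add: n_def s_def)
  also have "\<dots> = pochhammer s m * pochhammer (a + 2) m *
      (real n * (b + 1 + real m) + (a + 1) * (s + real m + real n)) / (fact n * pochhammer (b + 1) n)"
    unfolding p A B by (simp add: add_divide_distrib [symmetric]) (simp add: algebra_simps)
  also have "real n * (b + 1 + real m) + (a + 1) * (s + real m + real n) = (s + real m) * (a + 2 + real m)"
    by (simp add: n_def s_def algebra_simps)
  finally show ?case unfolding n_def [symmetric] using C by (simp only: s_def)
qed

subsection \<open>Coefficients of one sign and the mean square\<close>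

lemma mean_power_pos: "mean (\<lambda>x. ((1 + x) / 2) ^ m) > 0"
  by (rule mean_pos) (auto intro!: continuous_intros bexI[of _ 1])

text \<open>The normalised kernels are an approximate identity at 1. A pointwise bound on the
  oscillation of \<open>f\<close> that is affine in (1 - x) / 2 reduces this to one moment, whose
  ratio (a+1)/(a+b+2+m) tends to 0.\<close>

lemma mean_power_tendsto_at_1:
  assumes f: "continuous_on {-1..1} f"
  shows "(\<lambda>m. mean (\<lambda>x. f x * ((1 + x) / 2) ^ m) / mean (\<lambda>x. ((1 + x) / 2) ^ m)) \<longlonglongrightarrow> f 1"
proof (rule LIMSEQ_I)
  fix e :: real assume e: "0 < e"
  have "\<exists>d>0. \<forall>x\<in>{-1..1}. dist x 1 < d \<longrightarrow> dist (f x) (f 1) < e / 2"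
  proof -
    have "(1::real) \<in> {-1..1}" by simp
    then show ?thesis using f half_gt_zero[OF e] unfolding continuous_on_iff by blast
  qed
  then obtain d where d: "d > 0" "\<And>x. x \<in> {-1..1} \<Longrightarrow> dist x 1 < d \<Longrightarrow> dist (f x) (f 1) < e / 2"
    by blast
  have "compact (f ` {-1..1})" by (intro compact_continuous_image f) simp
  then obtain M where M: "\<And>x. x \<in> {-1..1} \<Longrightarrow> \<bar>f x\<bar> \<le> M"
    by (metis bounded_iff compact_imp_bounded imageI real_norm_def)
  \<comment> \<open>Where 1 - x >= d, this slope makes \<open>C * ((1 - x) / 2)\<close> at least 2M,
    which dominates the difference of two values of \<open>f\<close>.\<close>
  define C where "C = 4 * M / d"
  have M0: "M \<ge> 0" using M[of 1] by simp
  then have C0: "C \<ge> 0" using d by (simp add: C_def)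
  have bound: "\<bar>f x - f 1\<bar> \<le> e / 2 + C * ((1 - x) / 2)" if x: "x \<in> {-1..1}" for x
  proof (cases "dist x 1 < d")
    case True
    then have "\<bar>f x - f 1\<bar> < e / 2" using d(2)[OF x] by (simp add: dist_real_def)
    moreover have "C * ((1 - x) / 2) \<ge> 0" using C0 x by simp
    ultimately show ?thesis by linarith
  next
    case False
    then have "1 - x \<ge> d" using x by (auto simp: dist_real_def)
    then have "C * ((1 - x) / 2) \<ge> C * (d / 2)" using C0 by (intro mult_left_mono) auto
    also have "C * (d / 2) = 2 * M" using d by (simp add: C_def)
    finally show ?thesis using M[OF x] M[of 1] e by auto
  qed
  define V where "V m = mean (\<lambda>x. ((1 + x) / 2) ^ m)" for m
  have V: "V m > 0" for m unfolding V_def by (rule mean_power_pos)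
  have key: "\<bar>mean (\<lambda>x. f x * ((1 + x) / 2) ^ m) / V m - f 1\<bar> \<le> e / 2 + C * (a + 1) / (a + b + 2 + real m)" for m
  proof -
    have ratio: "mean (\<lambda>x. (1 - x) / 2 * ((1 + x) / 2) ^ m) = (a + 1) / (a + b + 2 + real m) * V m"
      using mean_moment[of 1 m] mean_moment[of 0 m] by (simp add: V_def pochhammer_Suc)
    have "mean (\<lambda>x. f x * ((1 + x) / 2) ^ m) - f 1 * V m =
          mean (\<lambda>x. f x * ((1 + x) / 2) ^ m - f 1 * ((1 + x) / 2) ^ m)"
      unfolding V_def mean_cmult [symmetric] by (intro mean_diff[symmetric] continuous_intros f) auto
    also have "\<bar>\<dots>\<bar> \<le> mean (\<lambda>x. \<bar>f x * ((1 + x) / 2) ^ m - f 1 * ((1 + x) / 2) ^ m\<bar>)"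
      by (intro abs_mean_le continuous_intros f) auto
    also have "\<dots> \<le> mean (\<lambda>x. (e / 2) * ((1 + x) / 2) ^ m + C * ((1 - x) / 2 * ((1 + x) / 2) ^ m))"
    proof (intro mean_mono continuous_intros f)
      fix x :: real assume x: "x \<in> {-1..1}"
      have v: "((1 + x) / 2) ^ m \<ge> 0" using x by simp
      have "\<bar>f x * ((1 + x) / 2) ^ m - f 1 * ((1 + x) / 2) ^ m\<bar> = \<bar>f x - f 1\<bar> * ((1 + x) / 2) ^ m"
        using v by (simp only: left_diff_distrib [symmetric] abs_mult abs_of_nonneg)
      also have "\<dots> \<le> (e / 2 + C * ((1 - x) / 2)) * ((1 + x) / 2) ^ m"
        by (rule mult_right_mono[OF bound[OF x] v])
      finally show "\<bar>f x * ((1 + x) / 2) ^ m - f 1 * ((1 + x) / 2) ^ m\<bar>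
          \<le> (e / 2) * ((1 + x) / 2) ^ m + C * ((1 - x) / 2 * ((1 + x) / 2) ^ m)"
        by (simp only: distrib_right mult.assoc)
    qed auto
    also have "\<dots> = (e / 2) * V m + C * mean (\<lambda>x. (1 - x) / 2 * ((1 + x) / 2) ^ m)"
      unfolding V_def mean_cmult [symmetric] by (intro mean_add continuous_intros) auto
    also have "\<dots> = (e / 2 + C * (a + 1) / (a + b + 2 + real m)) * V m"
      unfolding ratio by (simp add: algebra_simps)
    finally have "\<bar>mean (\<lambda>x. f x * ((1 + x) / 2) ^ m) - f 1 * V m\<bar>
       \<le> (e / 2 + C * (a + 1) / (a + b + 2 + real m)) * V m" .
    moreover have "\<bar>mean (\<lambda>x. f x * ((1 + x) / 2) ^ m) / V m - f 1\<bar> * V m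
       = \<bar>mean (\<lambda>x. f x * ((1 + x) / 2) ^ m) - f 1 * V m\<bar>"
      using V[of m] by (simp add: abs_mult_pos' field_simps)
    ultimately have "\<bar>mean (\<lambda>x. f x * ((1 + x) / 2) ^ m) / V m - f 1\<bar> * V m
       \<le> (e / 2 + C * (a + 1) / (a + b + 2 + real m)) * V m" by simp
    then show ?thesis using V[of m] by (rule mult_right_le_imp_le)
  qed
  have "(\<lambda>m. C * (a + 1) / (a + b + 2 + real m)) \<longlonglongrightarrow> 0"
    by (intro tendsto_divide_0[OF tendsto_const] filterlim_at_top_imp_at_infinity
        filterlim_tendsto_add_at_top[OF tendsto_const] filterlim_real_sequentially)
  then obtain N where N: "\<And>m. m \<ge> N \<Longrightarrow> \<bar>C * (a + 1) / (a + b + 2 + real m)\<bar> < e / 2"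
    using LIMSEQ_D[of _ 0 "e / 2"] e by (metis diff_zero half_gt_zero real_norm_def)
  show "\<exists>no. \<forall>m\<ge>no. norm (mean (\<lambda>x. f x * ((1 + x) / 2) ^ m) / mean (\<lambda>x. ((1 + x) / 2) ^ m) - f 1) < e"
  proof (intro exI allI impI)
    fix m assume "m \<ge> N"
    then show "norm (mean (\<lambda>x. f x * ((1 + x) / 2) ^ m) / mean (\<lambda>x. ((1 + x) / 2) ^ m) - f 1) < e"
      using key[of m] N[of m] unfolding V_def real_norm_def by linarith
  qed
qed

text \<open>Expanding the nonnegative kernel \<open>((1 + x) / 2) ^ m\<close>, whose Jacobi coefficients are nonnegative,
  replaces the convergence of the Jacobi series of \<open>f\<close> at 1.\<close>

lemma partial_sum_at_1_le:
  assumes f: "continuous_on {-1..1} f"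
    and s: "\<And>n. n > N \<Longrightarrow> s * jacobi_coeff a b f n \<ge> 0"
  shows "(\<Sum>n\<le>N. s * jacobi_coeff a b f n * jacobi_on a b n 1) \<le> s * f 1"
proof -
  define V where "V m = mean (\<lambda>x. ((1 + x) / 2) ^ m)" for m
  define D where "D m n = jacobi_coeff a b (\<lambda>x. ((1 + x) / 2) ^ m) n" for m n
  have V: "V m > 0" for m unfolding V_def by (rule mean_power_pos)
  have D: "D m n \<ge> 0" for m n
  proof -
    have "D m n = mean (\<lambda>x. 1 / sqrt (jacobi_sq_norm n) * (((1 + x) / 2) ^ m * jacobiP a b n x))"
      by (simp add: D_def jacobi_coeff_altdef jacobi_on_altdef)
    then show ?thesis
      using mean_power_jacobiP_nonneg[of m n] jacobi_sq_norm_pos[of n] by (simp only: mean_cmult) simp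
  qed
  \<comment> \<open>The kernel is a polynomial of degree \<open>m\<close>, so pairing it with
    \<open>f\<close> gives a finite sum and no convergence question arises.\<close>
  have expand: "mean (\<lambda>x. f x * ((1 + x) / 2) ^ m) = (\<Sum>n\<le>m. D m n * jacobi_coeff a b f n)" for m
  proof -
    obtain c where c: "\<And>x. poly (monom 1 m) ((1 + x) / 2) = (\<Sum>n\<le>m. c n * jacobi_on a b n x)"
      using poly_in_span_jacobi_on[of "monom 1 m" m] degree_monom_le by blast
    then have v: "((1 + x) / 2) ^ m = (\<Sum>n\<le>m. c n * jacobi_on a b n x)" for x
      by (simp add: poly_monom)
    have "D m n = c n" if "n \<le> m" for n
      unfolding D_def v jacobi_coeff_sum_jacobi_on using that by simp
    then show ?thesis
      unfolding v by (subst mean_mult_sum_jacobi_on[OF f]) simp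
  qed
  have lim: "(\<lambda>m. D m n / V m) \<longlonglongrightarrow> jacobi_on a b n 1" for n
    using mean_power_tendsto_at_1[OF continuous_on_jacobi_on, of n]
    by (simp add: D_def V_def jacobi_coeff_altdef mult.commute)
  have "(\<lambda>m. \<Sum>n\<le>N. s * jacobi_coeff a b f n * (D m n / V m)) \<longlonglongrightarrow>
        (\<Sum>n\<le>N. s * jacobi_coeff a b f n * jacobi_on a b n 1)"
    by (intro tendsto_intros lim)
  moreover have "(\<lambda>m. s * (mean (\<lambda>x. f x * ((1 + x) / 2) ^ m) / V m)) \<longlonglongrightarrow> s * f 1"
    unfolding V_def by (intro tendsto_intros mean_power_tendsto_at_1 f)
  moreover have "\<forall>m\<ge>N. (\<Sum>n\<le>N. s * jacobi_coeff a b f n * (D m n / V m))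
      \<le> s * (mean (\<lambda>x. f x * ((1 + x) / 2) ^ m) / V m)"
  proof (intro allI impI)
    fix m assume m: "m \<ge> N"
    have "(\<Sum>n\<le>N. s * jacobi_coeff a b f n * (D m n / V m))
        \<le> (\<Sum>n\<le>m. s * jacobi_coeff a b f n * (D m n / V m))"
      using m V[of m] by (intro sum_mono2) (auto intro!: mult_nonneg_nonneg divide_nonneg_pos s D)
    also have "\<dots> = s * (mean (\<lambda>x. f x * ((1 + x) / 2) ^ m) / V m)"
      unfolding expand sum_divide_distrib sum_distrib_left by (intro sum.cong refl) (simp add: mult_ac)
    finally show "(\<Sum>n\<le>N. s * jacobi_coeff a b f n * (D m n / V m))
      \<le> s * (mean (\<lambda>x. f x * ((1 + x) / 2) ^ m) / V m)" .
  qed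
  ultimately show ?thesis
    by (intro LIMSEQ_le[of _ _ _ "s * f 1"]) blast+
qed

lemma abs_jacobi_coeff_le:
  assumes f: "continuous_on {-1..1} f"
  shows "\<bar>jacobi_coeff a b f n\<bar> \<le> jacobi_on a b n 1 * mean (\<lambda>x. \<bar>f x\<bar>)"
proof -
  have "\<bar>jacobi_coeff a b f n\<bar> \<le> mean (\<lambda>x. \<bar>f x * jacobi_on a b n x\<bar>)"
    unfolding jacobi_coeff_altdef by (intro abs_mean_le continuous_intros f)
  also have "\<dots> \<le> mean (\<lambda>x. jacobi_on a b n 1 * \<bar>f x\<bar>)"
  proof (intro mean_mono continuous_intros f)
    fix x :: real assume "x \<in> {-1..1}"
    then show "\<bar>f x * jacobi_on a b n x\<bar> \<le> jacobi_on a b n 1 * \<bar>f x\<bar>"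
      unfolding abs_mult by (subst mult.commute) (intro mult_right_mono jacobi_on_le_at_1, auto)
  qed
  also have "\<dots> = jacobi_on a b n 1 * mean (\<lambda>x. \<bar>f x\<bar>)" by (rule mean_cmult)
  finally show ?thesis .
qed

text \<open>The half of Parseval's identity that rests on completeness. A uniform polynomial
  approximant lies in a finite span of the orthonormal polynomials, where the Fourier coefficients
  give the least mean square error. \<open>M\<close> lets the cutoff exceed a prescribed
  index.\<close>

lemma mean_square_le_partial_sum:
  assumes f: "continuous_on {-1..1} f" and e: "e > 0"
  shows "\<exists>N\<ge>M. mean (\<lambda>x. (f x)\<^sup>2) \<le> e\<^sup>2 + (\<Sum>n\<le>N. (jacobi_coeff a b f n)\<^sup>2)"
proof -
  obtain g where g: "real_polynomial_function g" "\<And>x. x \<in> {-1..1} \<Longrightarrow> \<bar>f x - g x\<bar> < e"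
    using Stone_Weierstrass_real_polynomial_function[OF compact_Icc f e] by blast
  then obtain d k where dk: "g = (\<lambda>x. \<Sum>i\<le>k. d i * x ^ i)"
    unfolding real_polynomial_function_iff_sum by blast
  define q where "q = (\<Sum>i\<le>k. smult (d i) ([:-1, 2:] ^ i))"
  have q: "poly q ((1 + x) / 2) = g x" for x
  proof -
    have "poly [:-1, 2:] ((1 + x) / 2) = x" by (simp add: field_simps)
    then show ?thesis by (simp only: q_def dk poly_sum poly_smult poly_power)
  qed
  define N where "N = max M (degree q)"
  have "degree q \<le> N" by (simp add: N_def)
  from poly_in_span_jacobi_on[OF this] obtain c
    where c: "\<And>x. g x = (\<Sum>n\<le>N. c n * jacobi_on a b n x)"
    unfolding q by blast
  have gc: "continuous_on {-1..1} g" unfolding c by (intro continuous_intros)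
  have "0 \<le> (\<Sum>n\<le>N. (c n - jacobi_coeff a b f n)\<^sup>2)" by (intro sum_nonneg) auto
  also have "\<dots> = (\<Sum>n\<le>N. c n * c n) - 2 * (\<Sum>n\<le>N. c n * jacobi_coeff a b f n)
      + (\<Sum>n\<le>N. (jacobi_coeff a b f n)\<^sup>2)"
    by (simp add: power2_eq_square algebra_simps sum.distrib sum_subtractf sum_distrib_left)
  finally have 1: "2 * (\<Sum>n\<le>N. c n * jacobi_coeff a b f n) - (\<Sum>n\<le>N. c n * c n)
      \<le> (\<Sum>n\<le>N. (jacobi_coeff a b f n)\<^sup>2)" by simp
  have fg: "mean (\<lambda>x. f x * g x) = (\<Sum>n\<le>N. c n * jacobi_coeff a b f n)"
    unfolding c by (rule mean_mult_sum_jacobi_on[OF f])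
  have "mean (\<lambda>x. g x * g x) = (\<Sum>n\<le>N. c n * jacobi_coeff a b g n)"
    using mean_mult_sum_jacobi_on[OF gc, of c N] unfolding c [symmetric] .
  also have "\<dots> = (\<Sum>n\<le>N. c n * c n)"
    unfolding c[abs_def] jacobi_coeff_sum_jacobi_on by (intro sum.cong) auto
  finally have gg: "mean (\<lambda>x. g x * g x) = (\<Sum>n\<le>N. c n * c n)" .
  have "mean (\<lambda>x. (f x)\<^sup>2) - 2 * mean (\<lambda>x. f x * g x) + mean (\<lambda>x. g x * g x)
       = mean (\<lambda>x. (f x)\<^sup>2 - 2 * (f x * g x) + g x * g x)"
    unfolding mean_cmult [symmetric]
    by (subst mean_add mean_diff, (intro continuous_intros f gc)+)+ simp
  also have "\<dots> \<le> mean (\<lambda>x. e\<^sup>2)"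
  proof (intro mean_mono continuous_intros f gc)
    fix x :: real assume "x \<in> {-1..1}"
    then have "\<bar>f x - g x\<bar> \<le> \<bar>e\<bar>" using g(2)[of x] by simp
    then have "(f x - g x)\<^sup>2 \<le> e\<^sup>2" by (simp only: abs_le_square_iff)
    then show "(f x)\<^sup>2 - 2 * (f x * g x) + g x * g x \<le> e\<^sup>2"
      by (simp add: power2_eq_square algebra_simps)
  qed
  finally have "mean (\<lambda>x. (f x)\<^sup>2) \<le> e\<^sup>2 + (\<Sum>n\<le>N. (jacobi_coeff a b f n)\<^sup>2)"
    using 1 unfolding fg gg by simp
  then show ?thesis by (intro exI[of _ N]) (simp add: N_def)
qed

lemma mean_square_le:
  assumes f: "continuous_on {-1..1} f" and s: "s \<in> {1, -1}"
    and coeff: "\<And>n. n > m \<Longrightarrow> s * jacobi_coeff a b f n \<ge> 0" and at_1: "s * f 1 \<le> 0"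
  shows "mean (\<lambda>x. (f x)\<^sup>2) \<le> 2 * (\<Sum>n\<le>m. (jacobi_on a b n 1)\<^sup>2) * (mean (\<lambda>x. \<bar>f x\<bar>))\<^sup>2"
proof -
  define A where "A = mean (\<lambda>x. \<bar>f x\<bar>)"
  define K where "K = (\<Sum>n\<le>m. (jacobi_on a b n 1)\<^sup>2)"
  let ?c = "jacobi_coeff a b f" and ?p = "\<lambda>n. jacobi_on a b n 1"
  have A: "A \<ge> 0"
    unfolding A_def using abs_mean_le[OF f] by linarith
  have c: "\<bar>?c n\<bar> \<le> ?p n * A" for n
    unfolding A_def by (rule abs_jacobi_coeff_le[OF f])
  have p: "?p n > 0" for n by (rule jacobi_on_at_1_pos)
  have low: "(\<Sum>n\<le>m. \<bar>?c n\<bar> * ?p n) \<le> K * A"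
    unfolding K_def sum_distrib_right
  proof (intro sum_mono)
    fix n
    show "\<bar>?c n\<bar> * ?p n \<le> (?p n)\<^sup>2 * A"
      using mult_right_mono[OF c[of n], of "?p n"] p[of n] by (simp add: power2_eq_square mult_ac)
  qed
  have abs_sum: "(\<Sum>n\<le>N. \<bar>?c n\<bar> * ?p n) \<le> 2 * (K * A)" if N: "N \<ge> m" for N
  proof -
    \<comment> \<open>The difference of modulus and signed coefficient is 0 above \<open>m\<close>
      and at most twice the modulus up to \<open>m\<close>; this is the origin of the factor 2. The
      signed sum itself is at most \<open>s * f 1\<close>, hence nonpositive.\<close>
    have "(\<Sum>n\<le>N. \<bar>?c n\<bar> * ?p n) - (\<Sum>n\<le>N. s * ?c n * ?p n)
        = (\<Sum>n\<le>N. (\<bar>?c n\<bar> - s * ?c n) * ?p n)"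
      by (simp add: sum_subtractf left_diff_distrib)
    also have "\<dots> = (\<Sum>n\<le>m. (\<bar>?c n\<bar> - s * ?c n) * ?p n)"
    proof (intro sum.mono_neutral_right ballI)
      fix n assume "n \<in> {..N} - {..m}"
      then have "s * ?c n \<ge> 0" by (intro coeff) auto
      then show "(\<bar>?c n\<bar> - s * ?c n) * ?p n = 0" using s by auto
    qed (use N in auto)
    also have "\<dots> \<le> (\<Sum>n\<le>m. 2 * (\<bar>?c n\<bar> * ?p n))"
    proof (intro sum_mono)
      fix n
      have "\<bar>?c n\<bar> - s * ?c n \<le> 2 * \<bar>?c n\<bar>" using s by auto
      then show "(\<bar>?c n\<bar> - s * ?c n) * ?p n \<le> 2 * (\<bar>?c n\<bar> * ?p n)"
        using p[of n] by (simp add: mult.assoc [symmetric])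
    qed
    also have "\<dots> \<le> 2 * (K * A)" using low by (simp add: sum_distrib_left [symmetric])
    finally have "(\<Sum>n\<le>N. \<bar>?c n\<bar> * ?p n) \<le> 2 * (K * A) + (\<Sum>n\<le>N. s * ?c n * ?p n)" by simp
    moreover have "(\<Sum>n\<le>N. s * ?c n * ?p n) \<le> s * f 1"
      by (intro partial_sum_at_1_le f coeff) (use N in auto)
    ultimately show ?thesis using at_1 by linarith
  qed
  have "mean (\<lambda>x. (f x)\<^sup>2) \<le> 2 * K * A\<^sup>2 + e" if e: "e > 0" for e
  proof -
    obtain N where N: "N \<ge> m" "mean (\<lambda>x. (f x)\<^sup>2) \<le> (sqrt e)\<^sup>2 + (\<Sum>n\<le>N. (?c n)\<^sup>2)"
      using mean_square_le_partial_sum[OF f real_sqrt_gt_zero[OF e], of m] by blast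
    \<comment> \<open>Bounding only one of the two factors of each square leaves the weighted
      absolute sum already controlled.\<close>
    have "(\<Sum>n\<le>N. (?c n)\<^sup>2) \<le> (\<Sum>n\<le>N. A * (\<bar>?c n\<bar> * ?p n))"
    proof (intro sum_mono)
      fix n
      have "(?c n)\<^sup>2 = \<bar>?c n\<bar> * \<bar>?c n\<bar>" by (simp add: power2_eq_square)
      also have "\<dots> \<le> \<bar>?c n\<bar> * (?p n * A)" by (intro mult_left_mono c) auto
      finally show "(?c n)\<^sup>2 \<le> A * (\<bar>?c n\<bar> * ?p n)" by (simp add: mult_ac)
    qed
    also have "\<dots> \<le> A * (2 * (K * A))"
      unfolding sum_distrib_left [symmetric] by (intro mult_left_mono abs_sum N A)
    finally show ?thesis using N(2) e by (simp add: power2_eq_square mult_ac)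
  qed
  then show ?thesis unfolding A_def K_def by (rule field_le_epsilon)
qed

subsection \<open>The sign uncertainty inequality\<close>

lemma uncertainty_inequality:
  assumes f: "continuous_on {-1..1} f" and nz: "\<exists>x\<in>{-1..1}. f x \<noteq> 0"
    and mean_f: "mean f \<le> 0" and s: "s \<in> {1, -1}"
    and coeff: "\<And>n. n > m \<Longrightarrow> s * jacobi_coeff a b f n \<ge> 0" and at_1: "s * f 1 \<le> 0"
    and r: "0 < r" "r \<le> 1" and sign: "\<And>x. -1 \<le> x \<Longrightarrow> x < 1 - r \<Longrightarrow> f x \<ge> 0"
  shows "1 \<le> 16 * (\<Sum>n\<le>m. (jacobi_on a b n 1)\<^sup>2) * ((r / 2) powr (a + 1) / ((a + 1) * Beta (a + 1) (b + 1)))"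
proof -
  define K where "K = (\<Sum>n\<le>m. (jacobi_on a b n 1)\<^sup>2)"
  define A where "A = mean (\<lambda>x. \<bar>f x\<bar>)"
  define Z where "Z = 2 powr (a + b + 1) * Beta (a + 1) (b + 1)"
  define C where "C = 2 * 2 powr b / Z"
  define W where "W = C * (r powr (a + 1) / (a + 1))"
  define g where "g = (\<lambda>x. if x \<in> {1 - r..1} then C * (1 - x) powr a else 0)"
  have Z: "Z > 0" using Beta_pos by (simp add: Z_def)
  have C: "C > 0" using Z by (simp add: C_def)
  have g: "(g has_integral W) {-1..1}"
  proof -
    have "((\<lambda>x. C * (1 - x) powr a) has_integral W) {1 - r..1}"
      unfolding W_def using a_ge r by (intro has_integral_mult_right has_integral_one_minus_powr) auto
    then show ?thesis unfolding g_def using r by (subst has_integral_restrict) auto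
  qed
  have w_le: "jacobi_weight a b x \<le> g x" if "x \<in> {1 - r..1}" for x
  proof -
    have x: "1 \<le> 1 + x" "1 + x \<le> 2" "1 - x \<ge> 0" using that r by auto
    \<comment> \<open>The extra factor 2 covers negative b, where (1+x)^b <= 1 <= 2^(1+b) for 1 + x
      >= 1.\<close>
    have "(1 + x) powr b \<le> 2 * 2 powr b"
    proof (cases "b \<ge> 0")
      case True
      then have "(1 + x) powr b \<le> 2 powr b" using x by (intro powr_mono2) auto
      moreover have "0 \<le> 2 powr b" by simp
      ultimately show ?thesis by linarith
    next
      case False
      then have "(1 + x) powr b \<le> 1 powr b" using x by (intro powr_mono2') auto
      also have "\<dots> = 2 powr 0" by simp
      also have "\<dots> \<le> 2 powr (1 + b)" using b_ge by (intro powr_mono) auto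
      finally show ?thesis by (simp add: powr_add)
    qed
    then have "(1 - x) powr a * (1 + x) powr b / Z \<le> (1 - x) powr a * (2 * 2 powr b) / Z"
      using Z by (intro divide_right_mono mult_left_mono) auto
    then show ?thesis
      using that by (simp add: g_def C_def jacobi_weight_def jacobi_weight0_def[abs_def] integral_weight0[unfolded jacobi_weight0_def[abs_def]] Z_def mult_ac)
  qed
  have g_nonneg: "g x \<ge> 0" for x using C by (simp add: g_def)
  have A: "A > 0" unfolding A_def
    by (rule mean_pos) (use f nz in \<open>auto intro!: continuous_intros\<close>)
  have S: "mean (\<lambda>x. (f x)\<^sup>2) \<le> 2 * K * A\<^sup>2"
    unfolding K_def A_def by (rule mean_square_le[OF f s coeff at_1])
  have K: "K > 0" unfolding K_def
    using jacobi_on_at_1_pos by (intro sum_pos) (auto simp: less_imp_neq[THEN not_sym])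
  \<comment> \<open>The bound \<open>2 * \<bar>f\<bar> \<le> e * f\<^sup>2 + 1 / e\<close> near 1 stands in for the Cauchy-Schwarz inequality.\<close>
  define e where "e = 1 / (4 * K * A)"
  have e: "e > 0" using K A by (simp add: e_def)
  \<comment> \<open>The majorant equals f plus two corrections: the term e f^2, and 1/e times a
    bound of the weight near 1. Keeping f itself lets its nonpositive mean be discarded after
    integration.\<close>
  have "A \<le> integral {-1..1} (\<lambda>x. (f x + e * (f x)\<^sup>2) * jacobi_weight a b x + 1 / e * g x)"
    unfolding A_def mean_def
  proof (rule integral_le)
    show "(\<lambda>x. \<bar>f x\<bar> * jacobi_weight a b x) integrable_on {-1..1}"
      by (intro mean_integrable continuous_intros f)
    show "(\<lambda>x. (f x + e * (f x)\<^sup>2) * jacobi_weight a b x + 1 / e * g x) integrable_on {-1..1}"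
      by (intro integrable_add mean_integrable continuous_intros f integrable_on_mult_right
          has_integral_integrable[OF g])
    fix x :: real assume x: "x \<in> {-1..1}"
    show "\<bar>f x\<bar> * jacobi_weight a b x \<le> (f x + e * (f x)\<^sup>2) * jacobi_weight a b x + 1 / e * g x"
    proof (cases "x < 1 - r")
      case True
      then have "f x \<ge> 0" using sign x by auto
      then have "\<bar>f x\<bar> \<le> f x + e * (f x)\<^sup>2" using e by simp
      then have "\<bar>f x\<bar> * jacobi_weight a b x \<le> (f x + e * (f x)\<^sup>2) * jacobi_weight a b x"
        by (intro mult_right_mono weight_nonneg)
      moreover have "1 / e * g x \<ge> 0" using e g_nonneg[of x] by simp
      ultimately show ?thesis by linarith
    next
      case False
      have "0 \<le> (e * \<bar>f x\<bar> - 1)\<^sup>2 / e" using e by simp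
      also have "\<dots> = e * (f x)\<^sup>2 - 2 * \<bar>f x\<bar> + 1 / e"
        using e by (simp add: power2_diff field_simps power2_eq_square)
      finally have "\<bar>f x\<bar> \<le> f x + e * (f x)\<^sup>2 + 1 / e" by linarith
      then have "\<bar>f x\<bar> * jacobi_weight a b x \<le> (f x + e * (f x)\<^sup>2 + 1 / e) * jacobi_weight a b x"
        by (intro mult_right_mono weight_nonneg)
      also have "\<dots> = (f x + e * (f x)\<^sup>2) * jacobi_weight a b x + 1 / e * jacobi_weight a b x"
        by (simp add: distrib_right)
      also have "\<dots> \<le> (f x + e * (f x)\<^sup>2) * jacobi_weight a b x + 1 / e * g x"
        using w_le[of x] x False e by (intro add_left_mono mult_left_mono) auto
      finally show ?thesis .
    qed
  qed
  also have "\<dots> = mean (\<lambda>x. f x + e * (f x)\<^sup>2) + 1 / e * W"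
    unfolding mean_def using g
    by (subst integral_add) (auto intro!: mean_integrable continuous_intros f integrable_on_divide simp: integral_unique has_integral_integrable)
  also have "mean (\<lambda>x. f x + e * (f x)\<^sup>2) = mean f + e * mean (\<lambda>x. (f x)\<^sup>2)"
    unfolding mean_cmult [symmetric] by (intro mean_add continuous_intros f)
  finally have "A \<le> e * mean (\<lambda>x. (f x)\<^sup>2) + 1 / e * W" using mean_f by simp
  also have "e * mean (\<lambda>x. (f x)\<^sup>2) \<le> e * (2 * K * A\<^sup>2)"
    using S e by (intro mult_left_mono) auto
  \<comment> \<open>The choice of \<open>e\<close> makes the quadratic term exactly half of
    \<open>A\<close>, so it can be absorbed on the left.\<close>
  also have "e * (2 * K * A\<^sup>2) = A / 2" using K A by (simp add: e_def power2_eq_square)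
  also have "1 / e * W = 4 * K * A * W" by (simp add: e_def)
  finally have "A * 1 \<le> A * (8 * K * W)" by (simp add: algebra_simps)
  then have "1 \<le> 8 * K * W" using A by (simp only: mult_le_cancel_left_pos)
  moreover have "W = 2 * ((r / 2) powr (a + 1) / ((a + 1) * Beta (a + 1) (b + 1)))"
  proof -
    have cancel: "2 * Q / (P * Q * B) * (R / c) = 2 * (R / P / (c * B))" if "Q > 0" for P Q R B c :: real
      using that by simp
    have "2 powr (a + b + 1) = 2 powr (a + 1) * 2 powr b" by (simp add: powr_add)
    moreover have "(r / 2) powr (a + 1) = r powr (a + 1) / 2 powr (a + 1)"
      using r by (simp add: powr_divide)
    ultimately show ?thesis
      unfolding W_def C_def Z_def by (simp only: cancel powr_gt_zero)
  qed
  ultimately show ?thesis by (simp add: K_def)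
qed

section \<open>Explicit constants from Gamma quotients\<close>

text \<open>Gamma(a+b+2) and Gamma(b+1) cancel between kernel and measure. The remaining quotients
  can be paired so that both have argument shift a + 1, which gives two powers with the same
  exponent as that of r.\<close>

lemma kernel_times_measure_le:
  fixes m :: nat
  assumes r: "0 < r"
  defines "k \<equiv> real (Suc m)"
  shows "(\<Sum>n\<le>m. (jacobi_on a b n 1)\<^sup>2) * ((r / 2) powr (a + 1) / ((a + 1) * Beta (a + 1) (b + 1)))
         \<le> (r * k\<^sup>2 * (a + b + 2) * (a + 2) / 2) powr (a + 1) / (Gamma (a + 2))\<^sup>2"
proof -
  define c where "c = a + 1"
  have c: "c > 0" using a_ge by (simp add: c_def)
  have G: "Gamma x > 0" if "x > 0" for x :: real using that by (rule Gamma_real_pos)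
  have p: "pochhammer x m = Gamma (x + real m) / Gamma x" if "x > 0" for x :: real
    using that by (intro pochhammer_Gamma) (auto elim!: nonpos_Ints_cases')
  have Beta: "(a + 1) * Beta (a + 1) (b + 1) = Gamma (a + 2) * Gamma (b + 1) / Gamma (a + b + 2)"
  proof -
    have "Gamma (a + 1 + 1) = (a + 1) * Gamma (a + 1)"
      using a_ge by (intro Gamma_plus1) (auto elim!: nonpos_Ints_cases')
    then show ?thesis by (simp add: Beta_def add_ac)
  qed
  have K: "(\<Sum>n\<le>m. (jacobi_on a b n 1)\<^sup>2) =
      (Gamma (a + b + 2 + real m) / Gamma (a + b + 2)) * (Gamma (a + 2 + real m) / Gamma (a + 2))
        / (Gamma k * (Gamma (b + 1 + real m) / Gamma (b + 1)))"
    using a_ge b_ge by (simp add: sum_jacobi_on_at_1_squared p k_def Gamma_fact add_ac)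
  have R1: "Gamma (a + b + 2 + real m) / Gamma (b + 1 + real m) \<le> ((a + b + 2) * k) powr c"
  proof -
    have "Gamma (b + 1 + real m + c) \<le> (b + 1 + real m + c) powr c * Gamma (b + 1 + real m)"
      using b_ge c by (intro Gamma_add_le) auto
    also have "b + 1 + real m + c = a + b + 2 + real m" by (simp add: c_def)
    finally have "Gamma (a + b + 2 + real m) / Gamma (b + 1 + real m) \<le> (a + b + 2 + real m) powr c"
      using G[of "b + 1 + real m"] b_ge by (simp add: field_simps)
    also have "\<dots> \<le> ((a + b + 2) * k) powr c"
    proof (intro powr_mono2)
      have "1 * real m \<le> (a + b + 2) * real m" using a_ge b_ge by (intro mult_right_mono) auto
      then show "a + b + 2 + real m \<le> (a + b + 2) * k" by (simp add: k_def distrib_left)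
    qed (use a_ge b_ge c in auto)
    finally show ?thesis .
  qed
  have R2: "Gamma (a + 2 + real m) / Gamma k \<le> ((a + 2) * k) powr c"
  proof -
    have "Gamma (k + c) \<le> (k + c) powr c * Gamma k"
      using c by (intro Gamma_add_le) (auto simp: k_def)
    also have "k + c = a + 2 + real m" by (simp add: c_def k_def)
    finally have "Gamma (a + 2 + real m) / Gamma k \<le> (a + 2 + real m) powr c"
      using G[of k] by (simp add: k_def field_simps)
    also have "\<dots> \<le> ((a + 2) * k) powr c"
    proof (intro powr_mono2)
      have "1 * real m \<le> (a + 2) * real m" using a_ge by (intro mult_right_mono) auto
      then show "a + 2 + real m \<le> (a + 2) * k" by (simp add: k_def distrib_left)
    qed (use a_ge c in auto)
    finally show ?thesis .
  qed
  have arrange: "(X / S) * (Y / T) / (L * (U / B)) * (R / (T * B / S)) = R * ((X / U) * (Y / L)) / T\<^sup>2"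
    if "S > 0" "T > 0" "L > 0" "U > 0" "B > 0" for X S Y T L U B R :: real
    using that by (simp add: field_simps power2_eq_square)
  have "(\<Sum>n\<le>m. (jacobi_on a b n 1)\<^sup>2) * ((r / 2) powr (a + 1) / ((a + 1) * Beta (a + 1) (b + 1)))
      = (r / 2) powr c * ((Gamma (a + b + 2 + real m) / Gamma (b + 1 + real m)) * (Gamma (a + 2 + real m) / Gamma k))
        / (Gamma (a + 2))\<^sup>2"
    unfolding K Beta unfolding c_def [symmetric]
    using a_ge b_ge by (intro arrange G) (auto simp: k_def)
  also have "\<dots> \<le> (r / 2) powr c * (((a + b + 2) * k) powr c * ((a + 2) * k) powr c) / (Gamma (a + 2))\<^sup>2"
    using G[of "a + 2 + real m"] G[of k] a_ge
    by (intro divide_right_mono mult_left_mono mult_mono R1 R2) (auto simp: k_def intro!: divide_nonneg_nonneg)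
  also have "(r / 2) powr c * (((a + b + 2) * k) powr c * ((a + 2) * k) powr c)
      = ((r / 2) * (((a + b + 2) * k) * ((a + 2) * k))) powr c"
    using r a_ge b_ge by (simp only: powr_mult) 
  also have "(r / 2) * (((a + b + 2) * k) * ((a + 2) * k)) = r * k\<^sup>2 * (a + b + 2) * (a + 2) / 2"
    by (simp add: power2_eq_square)
  finally show ?thesis by (simp add: c_def)
qed

abbreviation lower_bound :: real where
  "lower_bound \<equiv> 2 * Gamma (a + 2) powr (2 / (a + 1))
     / ((4 * exp (1/12)) powr (2 / (a + 1)) * (a + b + 2) * (a + 2))"

text \<open>Settles the case r > 1, where r k^2 >= 1 because k >= 1.\<close>

lemma lower_bound_le_1: "lower_bound \<le> 1"
proof -
  define c where "c = a + 1"
  have c: "c \<ge> 1/2" using a_ge by (simp add: c_def)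
  \<comment> \<open>Passing from 1 to 1 + c in two half steps gives (1+c)(1+c/2) rather than
    (1+c)^2; twice this is exactly (c+2)(a+2).\<close>
  have "Gamma (1 + c / 2) \<le> (1 + c / 2) powr (c / 2) * Gamma 1"
    using c by (intro Gamma_add_le) auto
  then have 1: "Gamma (1 + c / 2) \<le> (1 + c / 2) powr (c / 2)" by simp
  have "Gamma (1 + c / 2 + c / 2) \<le> (1 + c / 2 + c / 2) powr (c / 2) * Gamma (1 + c / 2)"
    using c by (intro Gamma_add_le) auto
  also have "\<dots> \<le> (1 + c / 2 + c / 2) powr (c / 2) * (1 + c / 2) powr (c / 2)"
    by (intro mult_left_mono 1) auto
  also have "\<dots> = ((1 + c) * (1 + c / 2)) powr (c / 2)"
    using c by (simp add: powr_mult add.commute)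
  finally have "Gamma (a + 2) powr (2 / c) \<le> (((1 + c) * (1 + c / 2)) powr (c / 2)) powr (2 / c)"
    using c by (intro powr_mono2) (auto simp: c_def add_ac intro!: less_imp_le[OF Gamma_real_pos])
  also have "\<dots> = (1 + c) * (1 + c / 2)" using c by (simp add: powr_powr)
  finally have "Gamma (a + 2) powr (2 / c) \<le> (1 + c) * (1 + c / 2)" .
  moreover have "2 * ((1 + c) * (1 + c / 2)) = (c + 2) * (a + 2)"
    by (simp add: c_def field_simps)
  ultimately have "2 * Gamma (a + 2) powr (2 / c) \<le> (c + 2) * (a + 2)" by linarith
  \<comment> \<open>From b >= -1/2 follows a + b + 2 >= c + 1/2, and e <= 4 exp(1/12) gives the
    factor 1 + 2/c; their product is c + 5/2 + 1/c.\<close>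
  also have "c + 2 \<le> (4 * exp (1/12)) powr (2 / c) * (a + b + 2)"
  proof -
    have "exp (1::real) \<le> 4 * exp (1/12)"
      using exp_le exp_ge_add_one_self[of "1/12::real"] by simp
    then have "exp 1 powr (2 / c) \<le> (4 * exp (1/12)) powr (2 / c)"
      using c by (intro powr_mono2) auto
    moreover have "1 + 2 / c \<le> exp 1 powr (2 / c)"
      using exp_ge_add_one_self[of "2 / c"] by (simp add: powr_def)
    ultimately have "1 + 2 / c \<le> (4 * exp (1/12)) powr (2 / c)" by linarith
    then have "(1 + 2 / c) * (c + 1/2) \<le> (4 * exp (1/12)) powr (2 / c) * (a + b + 2)"
      using c b_ge by (intro mult_mono) (auto simp: c_def)
    moreover have "(1 + 2 / c) * (c + 1/2) = c + 5/2 + 1 / c"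
      using c by (simp add: field_simps)
    moreover have "1 / c \<ge> 0" using c by simp
    ultimately show ?thesis by linarith
  qed
  then have "(c + 2) * (a + 2) \<le> (4 * exp (1/12)) powr (2 / c) * (a + b + 2) * (a + 2)"
    using a_ge by (intro mult_right_mono) auto
  finally have "2 * Gamma (a + 2) powr (2 / c) \<le> (4 * exp (1/12)) powr (2 / c) * (a + b + 2) * (a + 2)" .
  moreover have "(4 * exp (1/12)) powr (2 / c) * (a + b + 2) * (a + 2) > 0"
    using a_ge b_ge by (intro mult_pos_pos) auto
  ultimately show ?thesis unfolding c_def [symmetric] by (subst divide_le_eq_1_pos)
qed

lemma sign_uncertainty:
  assumes f: "continuous_on {-1..1} f" and nz: "\<exists>x\<in>{-1..1}. f x \<noteq> 0"
    and mean_f: "mean f \<le> 0" and s: "s \<in> {1, -1}"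
    and coeff: "\<And>n. n > m \<Longrightarrow> s * jacobi_coeff a b f n \<ge> 0" and at_1: "s * f 1 \<le> 0"
    and r: "0 < r" and sign: "\<And>x. -1 \<le> x \<Longrightarrow> x < 1 - r \<Longrightarrow> f x \<ge> 0"
  shows "lower_bound \<le> r * (real (Suc m))\<^sup>2"
proof (cases "r \<le> 1")
  case False
  have "1 * 1 \<le> r * (real (Suc m))\<^sup>2"
    using False by (intro mult_mono one_le_power) auto
  with lower_bound_le_1 show ?thesis by linarith
next
  case True
  define c where "c = a + 1"
  define k where "k = real (Suc m)"
  define Y where "Y = r * k\<^sup>2 * (a + b + 2) * (a + 2) / 2"
  define E where "E = 4 * exp (1/12 :: real)"
  have c: "c > 0" using a_ge by (simp add: c_def)
  have Y: "Y > 0" using r a_ge b_ge by (simp add: Y_def k_def)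
  have G: "Gamma (a + 2) > 0" using a_ge by (intro Gamma_real_pos) auto
  have "E > 0" by (simp add: E_def)
  have "16 \<le> E\<^sup>2"
    using power_mono[of 4 E 2] exp_ge_add_one_self[of "1/12::real"] by (simp add: E_def)
  have "1 \<le> 16 * ((\<Sum>n\<le>m. (jacobi_on a b n 1)\<^sup>2) * ((r / 2) powr (a + 1) / ((a + 1) * Beta (a + 1) (b + 1))))"
    using uncertainty_inequality[OF f nz mean_f s coeff at_1 r True sign] by (simp only: mult.assoc)
  also have "\<dots> \<le> 16 * (Y powr c / (Gamma (a + 2))\<^sup>2)"
    using kernel_times_measure_le[OF r, of m] by (simp add: Y_def k_def c_def)
  also have "\<dots> \<le> E\<^sup>2 * (Y powr c / (Gamma (a + 2))\<^sup>2)"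
    using \<open>16 \<le> E\<^sup>2\<close> by (intro mult_right_mono) auto
  finally have "(Gamma (a + 2))\<^sup>2 \<le> E\<^sup>2 * Y powr c"
    using G by (simp add: field_simps)
  \<comment> \<open>Taking the root of order c = a + 1 isolates \<open>Y\<close>, which is linear in
    r k^2.\<close>
  then have "((Gamma (a + 2))\<^sup>2) powr (1 / c) \<le> (E\<^sup>2 * Y powr c) powr (1 / c)"
    using c by (intro powr_mono2) auto
  moreover have sq: "(z\<^sup>2) powr (1 / c) = z powr (2 / c)" if "z > 0" for z :: real
    using that by (simp add: powr_powr flip: powr_numeral)
  moreover have "(E\<^sup>2 * Y powr c) powr (1 / c) = E powr (2 / c) * Y"
    using c Y \<open>E > 0\<close> by (simp add: powr_mult powr_powr sq)
  ultimately have "Gamma (a + 2) powr (2 / c) \<le> E powr (2 / c) * Y"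
    using G by simp
  then have "2 * Gamma (a + 2) powr (2 / c) \<le> r * k\<^sup>2 * (E powr (2 / c) * (a + b + 2) * (a + 2))"
    by (simp add: Y_def mult_ac)
  moreover have "E powr (2 / c) * (a + b + 2) * (a + 2) > 0"
    using a_ge b_ge by (intro mult_pos_pos) (auto simp: E_def)
  ultimately show ?thesis
    unfolding c_def E_def k_def by (simp only: pos_divide_le_eq)
qed

end

section \<open>Test functions and the infimum\<close>

text \<open>The radius 2 is always admissible, since no x satisfies -1 <= x < -1.\<close>

lemma r_I_le_2: "r_I f \<le> 2"
  unfolding r_I_def by (rule cInf_lower) (auto intro!: bdd_belowI[of _ 0])

lemma r_I_nonneg: "r_I f \<ge> 0"
  unfolding r_I_def by (rule cInf_greatest) (auto intro!: exI[of _ 2])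

lemma BB_le:
  assumes "f \<in> classB s a b" "\<exists>x\<in>{-1..1}. f x \<noteq> 0" "k \<ge> 1" "\<And>n. n \<ge> k \<Longrightarrow> s * jacobi_coeff a b f n \<ge> 0"
  shows "BB s a b \<le> 2 * (real k)\<^sup>2"
proof -
  have "BB s a b \<le> r_I f * (real (k_idx s a b f))\<^sup>2"
    unfolding BB_def using assms(1,2)
    by (intro cINF_lower bdd_belowI[of _ 0]) (auto simp: r_I_nonneg)
  moreover have "k_idx s a b f \<le> k"
    unfolding k_idx_def using assms(3,4) by (intro Least_le) auto
  then have "r_I f * (real (k_idx s a b f))\<^sup>2 \<le> 2 * (real k)\<^sup>2"
    using r_I_nonneg[of f] by (intro mult_mono r_I_le_2 power_mono) auto
  ultimately show ?thesis by linarith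
qed

context jacobi_parameters
begin

lemma jacobi_coeff_const: "jacobi_coeff a b (\<lambda>_. c) n = (if n = 0 then c else 0)"
  using jacobi_coeff_sum_jacobi_on[of "\<lambda>_. c" 0 n] by simp

lemma jacobi_coeff_jacobi_on: "jacobi_coeff a b (jacobi_on a b m) n = (if m = n then 1 else 0)"
  unfolding jacobi_coeff_altdef by (rule jacobi_on_orthonormal)

lemma const_in_classB: "(\<lambda>_. -1) \<in> classB 1 a b"
  by (auto simp: classB_def jacobi_coeff_const intro!: eventually_sequentiallyI[of 1])

lemma jacobi_on_1_in_classB: "jacobi_on a b 1 \<in> classB (-1) a b"
  using jacobi_on_at_1_pos[of 1]
  by (auto simp: classB_def jacobi_coeff_jacobi_on intro!: continuous_intros eventually_sequentiallyI[of 2])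

lemma jacobi_on_1_nonzero: "\<exists>x\<in>{-1..1}. jacobi_on a b 1 x \<noteq> 0"
  using jacobi_on_at_1_pos[of 1] by (intro bexI[of _ 1]) auto

lemma classB_lower_bound:
  assumes f: "f \<in> classB s a b" and nz: "\<exists>x\<in>{-1..1}. f x \<noteq> 0" and s: "s \<in> {1, -1}"
  shows "lower_bound \<le> r_I f * (real (k_idx s a b f))\<^sup>2"
proof -
  define k where "k = k_idx s a b f"
  obtain N where "\<forall>n\<ge>N. s * jacobi_coeff a b f n \<ge> 0"
    using f by (auto simp: classB_def eventually_sequentially)
  then have "1 \<le> max 1 N \<and> (\<forall>n\<ge>max 1 N. s * jacobi_coeff a b f n \<ge> 0)" by simp
  then have k: "1 \<le> k \<and> (\<forall>n\<ge>k. s * jacobi_coeff a b f n \<ge> 0)"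
    unfolding k_def k_idx_def by (rule LeastI)
  then have k_sq: "(real k)\<^sup>2 > 0" by simp
  have mean_f: "mean f \<le> 0"
    using f by (simp add: classB_def jacobi_coeff_altdef)
  \<comment> \<open>The infimum need not be attained, so the bound is proved for every admissible
    radius; dividing by k^2 isolates the radius.\<close>
  have "lower_bound / (real k)\<^sup>2 \<le> r_I f"
    unfolding r_I_def
  proof (rule cInf_greatest)
    show "{r. 0 < r \<and> r \<le> 2 \<and> (\<forall>x. -1 \<le> x \<and> x < 1 - r \<longrightarrow> f x \<ge> 0)} \<noteq> {}"
      by (auto intro!: exI[of _ 2])
    fix r assume r: "r \<in> {r. 0 < r \<and> r \<le> 2 \<and> (\<forall>x. -1 \<le> x \<and> x < 1 - r \<longrightarrow> f x \<ge> 0)}"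
    \<comment> \<open>Instantiated with m = k - 1, so that the indices n > m are exactly those with
      n >= k.\<close>
    have "lower_bound \<le> r * (real (Suc (k - 1)))\<^sup>2"
      by (rule sign_uncertainty[OF _ nz mean_f s]) (use f r k in \<open>auto simp: classB_def\<close>)
    moreover have "Suc (k - 1) = k" using k by simp
    ultimately show "lower_bound / (real k)\<^sup>2 \<le> r" by (simp only: pos_divide_le_eq k_sq)
  qed
  then show ?thesis unfolding k_def [symmetric] by (simp only: pos_divide_le_eq k_sq)
qed

end

theorem mainTheorem7:
  fixes \<alpha> \<beta> :: real
  assumes "\<beta> \<ge> -1/2" and "\<alpha> \<ge> \<beta>"
  shows "(\<forall>s\<in>{1, -1::real}.
            2 * Gamma (\<alpha> + 2) powr (2 / (\<alpha> + 1))
              / ((4 * exp (1/12)) powr (2 / (\<alpha> + 1)) * (\<alpha> + \<beta> + 2) * (\<alpha> + 2))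
            \<le> BB s \<alpha> \<beta>)
         \<and> BB 1 \<alpha> \<beta> \<le> 2 \<and> BB (-1) \<alpha> \<beta> \<le> 8"
proof -
  interpret jacobi_parameters \<alpha> \<beta> using assms by unfold_locales
  have "lower_bound \<le> BB s \<alpha> \<beta>" if s: "s \<in> {1, -1}" for s
    unfolding BB_def
  proof (rule cINF_greatest)
    \<comment> \<open>An infimum of reals can be bounded below only over a nonempty set; the
      functions giving the upper bounds serve as witnesses.\<close>
    show "{f \<in> classB s \<alpha> \<beta>. \<exists>x\<in>{-1..1}. f x \<noteq> 0} \<noteq> {}"
    proof (cases "s = 1")
      case True
      have "\<exists>x\<in>{-1..1::real}. (-1::real) \<noteq> 0" by (intro bexI[of _ 0]) auto
      with True const_in_classB show ?thesis by blast
    next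
      case False
      with s have "s = -1" by simp
      with jacobi_on_1_in_classB jacobi_on_1_nonzero show ?thesis by blast
    qed
  qed (use classB_lower_bound s in auto)
  moreover have "BB 1 \<alpha> \<beta> \<le> 2 * (real 1)\<^sup>2"
    by (rule BB_le[OF const_in_classB]) (auto simp: jacobi_coeff_const intro!: bexI[of _ 0])
  \<comment> \<open>For f = p 1 and s = -1 the coefficient of index 1 has the wrong sign, so the
    index is 2 and the bound is 2 * 2^2 = 8.\<close>
  moreover have "BB (-1) \<alpha> \<beta> \<le> 2 * (real 2)\<^sup>2"
    by (rule BB_le[OF jacobi_on_1_in_classB jacobi_on_1_nonzero]) (auto simp: jacobi_coeff_jacobi_on)
  ultimately show ?thesis by simp
qed

end
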